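(* Suppose $F=0$. Let $\widetilde U_h,\widetilde V_h\in Q_h^{p_t}(Q_T)$ be a solution of the scheme: $\widetilde U_h(\cdot,0)=U_{0,h_x}$, $\widetilde V_h(\cdot,0)=V_{0,h_x}$ in $\Omega$, and $$(\partial_t\widetilde U_h,\chi_h)_{L^2(Q_T)}-(\widetilde V_h,\chi_h)_{L^2(Q_T)}=0\quad\text{for all }\chi_h\in\partial_tQ_h^{p_t}(Q_T),$$ $$(\partial_t\widetilde V_h,\lambda_h)_{L^2(Q_T)}+(c^2\nabla_x\widetilde U_h,\nabla_x\lambda_h)_{L^2(Q_T)}+(g(\widetilde U_h),\lambda_h)_{L^2(Q_T)}=(F,\lambda_h)_{L^2(Q_T)}\quad\text{for all }\lambda_h\in\partial_tQ_h^{p_t}(Q_T).$$ Then, for all $j=0,\dots,N_t$, $$\begin{aligned}&\tfrac12\big(\|\widetilde V_h(\cdot,t_j)\|^2_{L^2(\Omega)}+\|c\nabla_x\widetilde U_h(\cdot,t_j)\|^2_{L^2(\Omega)}\big)+\|G(\widetilde U_h(\cdot,t_j))\|^2_{L^2(\Omega)}\\&\qquad=\tfrac12\big(\|V_{0,h_x}\|^2_{L^2(\Omega)}+\|c\nabla_xU_{0,h_x}\|^2_{L^2(\Omega)}\big)+\|G(U_{0,h_x})\|^2_{L^2(\Omega)},\end{aligned}$$ where $G(U)=\int_0^Ug(V)\,dV$.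
   Context: $\Omega\subset\mathbb R^d$ ($d=1,2,3$) is a polytopal Lipschitz domain, $T>0$ is a finite time, $Q_T=\Omega\times(0,T)$, $c\in C(\overline\Omega)$ with $c(x)\ge c_0>0$ for all $x\in\Omega$, $U_0\in H^1_0(\Omega)$, $V_0\in L^2(\Omega)$, and $g:\mathbb R\to\mathbb R$ is a nonlinear term with $g(0)=0$. The scheme discretizes the semilinear wave equation $\partial_t^2U-\mathrm{div}_x(c^2\nabla_xU)+g(U)=F$ in $Q_T$, $U=0$ on $\partial\Omega\times(0,T)$, $U(\cdot,0)=U_0$, $\partial_tU(\cdot,0)=V_0$ in $\Omega$, written in first-order-in-time form with $V=\partial_tU$. $S_{h_x}(\Omega)\subset H^1_0(\Omega)$ is a space of piecewise polynomial functions of degree at most $p_x\ge1$ on a shape-regular, conforming simplicial mesh of $\Omega$ with mesh size $h_x$. For nodes $0=t_0<t_1<\dots<t_{N_t}=T$ and an integer $p_t\ge1$, $S_{h_t}^{p_t}(0,T)$ is the space of continuous piecewise polynomials of degree $p_t$ on this mesh (i.e. of degree at most $p_t$ on each $[t_{i-1},t_i]$); $\partial_tS_{h_t}^{p_t}(0,T)$ is the space of derivatives of its elements. Set $Q_h^{p_t}(Q_T)=S_{h_x}(\Omega)\otimes S_{h_t}^{p_t}(0,T)$ and $\partial_tQ_h^{p_t}(Q_T)=S_{h_x}(\Omega)\otimes\partial_tS_{h_t}^{p_t}(0,T)$. $U_{0,h_x},V_{0,h_x}\in S_{h_x}(\Omega)$ are defined by $(c^2\nabla_xU_{0,h_x},\nabla_xW)_{L^2(\Omega)}=(c^2\nabla_xU_0,\nabla_xW)_{L^2(\Omega)}$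 and $(V_{0,h_x},W)_{L^2(\Omega)}=(V_0,W)_{L^2(\Omega)}$ for all $W\in S_{h_x}(\Omega)$.
   Formalization: The term ‖G(·)‖²_{L²(Ω)} is replaced on both sides by ∫_Ω G(·) dx, since the identity as printed fails (e.g. g(u)=u, one time step, p_t=1, one hat function, U_0=0); g is assumed integrable on bounded intervals so that G is defined. *)

theory Defs
  imports "HOL-Analysis.Analysis" "HOL-Computational_Algebra.Polynomial"
begin

section \<open>Domains\<close>

text \<open>
  Near each boundary point the domain is the strict supergraph, in some direction \<open>\<nu>\<close>, of a
  Lipschitz function of the component orthogonal to \<open>\<nu>\<close>.
\<close>

definition lipschitz_domain :: "(real^'d) set \<Rightarrow> bool" where
  "lipschitz_domain \<Omega> \<longleftrightarrow>
     open \<Omega> \<and> connected \<Omega> \<and> bounded \<Omega> \<and> \<Omega> \<noteq> {} \<and>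
     (\<forall>x\<in>frontier \<Omega>. \<exists>\<nu> \<gamma> L r. norm \<nu> = 1 \<and> 0 < r \<and>
        L-lipschitz_on {z. z \<bullet> \<nu> = 0} (\<gamma> :: real^'d \<Rightarrow> real) \<and>
        \<Omega> \<inter> ball x r = {y \<in> ball x r. \<gamma> (y - (y \<bullet> \<nu>) *\<^sub>R \<nu>) < y \<bullet> \<nu>})"

definition polytopal :: "(real^'d) set \<Rightarrow> bool" where
  "polytopal \<Omega> \<longleftrightarrow> (\<exists>\<P>. finite \<P> \<and> (\<forall>P\<in>\<P>. polytope P) \<and> closure \<Omega> = \<Union>\<P>)"

section \<open>The Lebesgue space of square-integrable functions\<close>

text \<open>
  The values are in an inner product space so that scalar functions and vector fields are treated
  alike. Elements are functions on the whole space, of which only the restriction to \<open>\<Omega>\<close>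
  up to null sets matters.
\<close>

definition L2 :: "'a::euclidean_space set \<Rightarrow> ('a \<Rightarrow> 'b::euclidean_space) set" where
  "L2 \<Omega> = {f. f \<in> borel_measurable (lebesgue_on \<Omega>) \<and>
               integrable (lebesgue_on \<Omega>) (\<lambda>x. (norm (f x))\<^sup>2)}"

definition L2_inner ::
    "'a::euclidean_space set \<Rightarrow> ('a \<Rightarrow> 'b::euclidean_space) \<Rightarrow> ('a \<Rightarrow> 'b) \<Rightarrow> real" where
  "L2_inner \<Omega> f h = (\<integral>x. f x \<bullet> h x \<partial>lebesgue_on \<Omega>)"

definition L2_norm :: "'a::euclidean_space set \<Rightarrow> ('a \<Rightarrow> 'b::euclidean_space) \<Rightarrow> real" where
  "L2_norm \<Omega> f = sqrt (L2_inner \<Omega> f f)"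

text \<open>
  The inner product of \<open>L\<^sup>2(Q\<^sub>T)\<close> under the identification with \<open>L\<^sup>2(0,T; L\<^sup>2(\<Omega>))\<close>.
  The iterated form is needed because a spatial weak gradient is fixed, for each time separately,
  only up to a null set of \<open>\<Omega>\<close>, so that an arbitrary choice need not be jointly measurable.
\<close>

definition L2_QT_inner ::
    "'a::euclidean_space set \<Rightarrow> real \<Rightarrow> ('a \<Rightarrow> real \<Rightarrow> 'b::euclidean_space)
       \<Rightarrow> ('a \<Rightarrow> real \<Rightarrow> 'b) \<Rightarrow> real" where
  "L2_QT_inner \<Omega> T f h =
     (\<integral>s. L2_inner \<Omega> (\<lambda>x. f x s) (\<lambda>x. h x s) \<partial>lebesgue_on {0<..<T})"

section \<open>Sobolev spaces\<close>

primrec C_k :: "nat \<Rightarrow> ((real^'d) \<Rightarrow> real) \<Rightarrow> bool" where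
  "C_k 0 f \<longleftrightarrow> continuous_on UNIV f"
| "C_k (Suc k) f \<longleftrightarrow> f differentiable_on UNIV \<and>
     (\<forall>i. C_k k (\<lambda>x. frechet_derivative f (at x) (axis i 1)))"

definition test_functions :: "(real^'d) set \<Rightarrow> ((real^'d) \<Rightarrow> real) set" where
  "test_functions \<Omega> = {\<phi>. (\<forall>k. C_k k \<phi>) \<and>
      compact (closure {x. \<phi> x \<noteq> 0}) \<and> closure {x. \<phi> x \<noteq> 0} \<subseteq> \<Omega>}"

definition classical_grad :: "((real^'d) \<Rightarrow> real) \<Rightarrow> real^'d \<Rightarrow> real^'d" where
  "classical_grad f x = (\<chi> i. frechet_derivative f (at x) (axis i 1))"

definition is_weak_grad ::
    "(real^'d) set \<Rightarrow> ((real^'d) \<Rightarrow> real) \<Rightarrow> (real^'d \<Rightarrow> real^'d) \<Rightarrow> bool" where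
  "is_weak_grad \<Omega> u D \<longleftrightarrow> D \<in> L2 \<Omega> \<and>
     (\<forall>\<phi>\<in>test_functions \<Omega>. \<forall>i.
        (\<integral>x. u x * classical_grad \<phi> x $ i \<partial>lebesgue_on \<Omega>) =
        - (\<integral>x. D x $ i * \<phi> x \<partial>lebesgue_on \<Omega>))"

definition H1 :: "(real^'d) set \<Rightarrow> ((real^'d) \<Rightarrow> real) set" where
  "H1 \<Omega> = {u \<in> L2 \<Omega>. \<exists>D. is_weak_grad \<Omega> u D}"

text \<open>The weak gradient is unique up to a null set; \<open>wgrad\<close> picks a representative.\<close>

definition wgrad :: "(real^'d) set \<Rightarrow> ((real^'d) \<Rightarrow> real) \<Rightarrow> real^'d \<Rightarrow> real^'d" where
  "wgrad \<Omega> u = (SOME D. is_weak_grad \<Omega> u D)"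

definition H1_0 :: "(real^'d) set \<Rightarrow> ((real^'d) \<Rightarrow> real) set" where
  "H1_0 \<Omega> = {u \<in> H1 \<Omega>. \<exists>\<phi>. (\<forall>n. \<phi> n \<in> test_functions \<Omega>) \<and>
      (\<lambda>n::nat. L2_norm \<Omega> (\<lambda>x. \<phi> n x - u x)) \<longlonglongrightarrow> 0 \<and>
      (\<lambda>n. L2_norm \<Omega> (\<lambda>x. classical_grad (\<phi> n) x - wgrad \<Omega> u x)) \<longlonglongrightarrow> 0}"

section \<open>Discretization in space\<close>

text \<open>
  Polynomials of total degree at most \<open>p\<close>; a multi-index is a function on the coordinates.
\<close>

definition poly_fun :: "nat \<Rightarrow> ((real^'d) \<Rightarrow> real) \<Rightarrow> bool" where
  "poly_fun p f \<longleftrightarrow> (\<exists>a :: ('d \<Rightarrow> nat) \<Rightarrow> real.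
     \<forall>x. f x = (\<Sum>\<alpha> | sum \<alpha> UNIV \<le> p. a \<alpha> * (\<Prod>i\<in>UNIV. x $ i ^ \<alpha> i)))"

text \<open>
  Conformity of the mesh is the face condition in \<open>triangulation\<close>. The shape-regularity
  constant \<open>\<sigma>\<close> bounds the ratio of the diameter to the radius of an inscribed ball.
\<close>

definition simplicial_mesh :: "real \<Rightarrow> real \<Rightarrow> (real^'d) set \<Rightarrow> (real^'d) set set \<Rightarrow> bool" where
  "simplicial_mesh \<sigma> h \<Omega> \<T> \<longleftrightarrow>
     triangulation \<T> \<and> (\<forall>K\<in>\<T>. int CARD('d) simplex K) \<and> \<Union>\<T> = closure \<Omega> \<and>
     (\<forall>K\<in>\<T>. \<exists>z r. 0 < r \<and> cball z r \<subseteq> K \<and> diameter K \<le> \<sigma> * r) \<and>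
     h = Max (diameter ` \<T>)"

text \<open>
  Being polynomial on each closed simplex selects the continuous representative of a
  piecewise polynomial function in the Sobolev space. Any linear space of such functions is admitted.
\<close>

definition space_discretization ::
    "(real^'d) set \<Rightarrow> (real^'d) set set \<Rightarrow> nat \<Rightarrow> ((real^'d) \<Rightarrow> real) set \<Rightarrow> bool" where
  "space_discretization \<Omega> \<T> p S \<longleftrightarrow>
     S \<subseteq> H1_0 \<Omega> \<and>
     (\<lambda>x. 0) \<in> S \<and> (\<forall>v\<in>S. \<forall>w\<in>S. (\<lambda>x. v x + w x) \<in> S) \<and> (\<forall>v\<in>S. \<forall>a. (\<lambda>x. a * v x) \<in> S) \<and>
     (\<forall>v\<in>S. \<forall>K\<in>\<T>. \<exists>f. poly_fun p f \<and> (\<forall>x\<in>K. v x = f x))"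

section \<open>Discretization in time\<close>

definition time_mesh :: "real \<Rightarrow> nat \<Rightarrow> (nat \<Rightarrow> real) \<Rightarrow> bool" where
  "time_mesh T N t \<longleftrightarrow> t 0 = 0 \<and> t N = T \<and> (\<forall>i<N. t i < t (Suc i))"

definition S_time :: "nat \<Rightarrow> (nat \<Rightarrow> real) \<Rightarrow> nat \<Rightarrow> (real \<Rightarrow> real) set" where
  "S_time N t p = {\<theta>. continuous_on {t 0..t N} \<theta> \<and>
     (\<forall>i<N. \<exists>q :: real poly. degree q \<le> p \<and> (\<forall>s\<in>{t i..t (Suc i)}. \<theta> s = poly q s))}"

text \<open>The derivatives exist off the nodes; the values at the nodes are left arbitrary.\<close>

definition dS_time :: "nat \<Rightarrow> (nat \<Rightarrow> real) \<Rightarrow> nat \<Rightarrow> (real \<Rightarrow> real) set" where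
  "dS_time N t p = {\<eta>. \<exists>\<theta>\<in>S_time N t p. \<forall>i<N. \<forall>s\<in>{t i<..<t (Suc i)}.
     (\<theta> has_real_derivative \<eta> s) (at s)}"

section \<open>The scheme\<close>

definition tensor_space ::
    "('a \<Rightarrow> real) set \<Rightarrow> (real \<Rightarrow> real) set \<Rightarrow> ('a \<Rightarrow> real \<Rightarrow> real) set" where
  "tensor_space A B = {u. \<exists>(n::nat) \<phi> \<theta>. (\<forall>k<n. \<phi> k \<in> A \<and> \<theta> k \<in> B) \<and>
     u = (\<lambda>x s. \<Sum>k<n. \<phi> k x * \<theta> k s)}"

definition dt :: "('a \<Rightarrow> real \<Rightarrow> real) \<Rightarrow> 'a \<Rightarrow> real \<Rightarrow> real" where
  "dt u x s = deriv (\<lambda>r. u x r) s"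

definition grad_x :: "(real^'d) set \<Rightarrow> (real^'d \<Rightarrow> real \<Rightarrow> real) \<Rightarrow> real^'d \<Rightarrow> real \<Rightarrow> real^'d" where
  "grad_x \<Omega> u x s = wgrad \<Omega> (\<lambda>y. u y s) x"

definition scheme_solution ::
    "(real^'d) set \<Rightarrow> real \<Rightarrow> (real^'d \<Rightarrow> real) \<Rightarrow> (real \<Rightarrow> real) \<Rightarrow> (real^'d \<Rightarrow> real \<Rightarrow> real) \<Rightarrow>
     (real^'d \<Rightarrow> real) set \<Rightarrow> nat \<Rightarrow> (nat \<Rightarrow> real) \<Rightarrow> nat \<Rightarrow>
     (real^'d \<Rightarrow> real) \<Rightarrow> (real^'d \<Rightarrow> real) \<Rightarrow>
     (real^'d \<Rightarrow> real \<Rightarrow> real) \<Rightarrow> (real^'d \<Rightarrow> real \<Rightarrow> real) \<Rightarrow> bool" where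
  "scheme_solution \<Omega> T c g F S N t p U0h V0h U V \<longleftrightarrow>
     U \<in> tensor_space S (S_time N t p) \<and> V \<in> tensor_space S (S_time N t p) \<and>
     (\<forall>x\<in>\<Omega>. U x 0 = U0h x) \<and> (\<forall>x\<in>\<Omega>. V x 0 = V0h x) \<and>
     (\<forall>\<xi>\<in>tensor_space S (dS_time N t p).
        L2_QT_inner \<Omega> T (dt U) \<xi> - L2_QT_inner \<Omega> T V \<xi> = 0) \<and>
     (\<forall>\<mu>\<in>tensor_space S (dS_time N t p).
        L2_QT_inner \<Omega> T (dt V) \<mu>
        + L2_QT_inner \<Omega> T (\<lambda>x s. (c x)\<^sup>2 *\<^sub>R grad_x \<Omega> U x s) (grad_x \<Omega> \<mu>)
        + L2_QT_inner \<Omega> T (\<lambda>x s. g (U x s)) \<mu>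
        = L2_QT_inner \<Omega> T F \<mu>)"

text \<open>
  The oriented integral from \<open>0\<close> to \<open>u\<close>, also for negative \<open>u\<close>.
\<close>

definition potential :: "(real \<Rightarrow> real) \<Rightarrow> real \<Rightarrow> real" where
  "potential g u = (LBINT v=0..u. g v)"

text \<open>
  The nonlinear part of the conserved energy is \<open>\<integral>\<^sub>\<Omega> G(u) dx\<close> with \<open>G\<close> the
  potential. It is not the squared \<open>L\<^sup>2\<close> norm \<open>\<integral>\<^sub>\<Omega> G(u)\<^sup>2 dx\<close>, which
  for \<open>g(u) = u\<close> is quartic in \<open>u\<close> and is not conserved by the scheme.
\<close>

definition potential_energy ::
    "(real^'d) set \<Rightarrow> (real \<Rightarrow> real) \<Rightarrow> (real^'d \<Rightarrow> real) \<Rightarrow> real" where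
  "potential_energy \<Omega> g u = (\<integral>x. potential g (u x) \<partial>lebesgue_on \<Omega>)"

end

theory Submission
  imports Defs
begin

text \<open>
  The scheme conserves energy because the time derivatives of the discrete solution are themselves
  admissible test functions. With \<open>\<xi> = \<partial>\<^sub>t V\<close> in the first equation and \<open>\<mu> = \<partial>\<^sub>t U\<close> in the second, the
  terms \<open>(\<partial>\<^sub>t U, \<partial>\<^sub>t V)\<close> cancel, and what remains is
  \<open>(V, \<partial>\<^sub>t V) + (c\<^sup>2 \<nabla>U, \<nabla>\<partial>\<^sub>t U) + (g(U), \<partial>\<^sub>t U) = 0\<close>. Each summand is the time derivative of one part of
  the energy. Since the test functions may jump at the nodes, both can be cut off to a single time
  element, so the energy has the same value at the two ends of every element
  (\<open>energy_conserved_on_element\<close>), and the theorem follows by induction over the elements.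
  On one element \<open>U\<close> and \<open>V\<close> are polynomials in time with coefficients in the spatial space,
  which reduces the three terms to the following.

  The first two terms are quadratic. Expanded in the coefficients they are polynomials in time, and
  the fundamental theorem of calculus applies (\<open>quadratic_energy_difference\<close>). For the gradient term
  this expansion uses that a chosen weak gradient is linear almost everywhere (\<open>wgrad_sum\<close>). A defect of
  linearity is orthogonal to all test functions, hence to all gradients of test functions, because
  their components are again test functions, hence to its own summands, because functions in
  \<open>H1_0\<close> are limits of test functions together with their gradients. So it is orthogonal to itself
  and vanishes.

  For the nonlinear term \<open>g\<close> is only locally integrable, so that \<open>g(U)\<close> may fail to be integrable over
  the domain at some times, and \<open>\<partial>\<^sub>t G(U) = g(U) \<partial>\<^sub>t U\<close> may fail at some points. At a fixed point in
  space, however, \<open>U\<close> is piecewise monotone in time, and substitution on each monotone piece gives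
  the integrated chain rule together with a bound on \<open>\<integral> \<bar>g(U) \<partial>\<^sub>t U\<bar> dt\<close> in which the number of pieces is
  controlled by the degree (\<open>poly_chain_rule\<close>). This bound is uniform in space, so Fubini's theorem
  exchanges the two integrations (\<open>potential_energy_difference\<close>).
\<close>

section \<open>Square-integrable functions\<close>

lemma L2_measurable: "f \<in> L2 \<Omega> \<Longrightarrow> f \<in> borel_measurable (lebesgue_on \<Omega>)"
  by (simp add: L2_def)

lemma L2_integrable_inner:
  assumes "f \<in> L2 \<Omega>" "h \<in> L2 \<Omega>"
  shows "integrable (lebesgue_on \<Omega>) (\<lambda>x. f x \<bullet> h x)"
proof (rule Bochner_Integration.integrable_bound)
  show "integrable (lebesgue_on \<Omega>) (\<lambda>x. (norm (f x))\<^sup>2 + (norm (h x))\<^sup>2)"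
    using assms by (simp add: L2_def)
  note [measurable] = assms[THEN L2_measurable]
  show "(\<lambda>x. f x \<bullet> h x) \<in> borel_measurable (lebesgue_on \<Omega>)" by measurable
  have "\<bar>u \<bullet> v\<bar> \<le> (norm u)\<^sup>2 + (norm v)\<^sup>2" for u v :: 'b
  proof -
    have "2 * (norm u * norm v) \<le> (norm u)\<^sup>2 + (norm v)\<^sup>2"
      using sum_squares_bound[of "norm u" "norm v"] by simp
    moreover have "\<bar>u \<bullet> v\<bar> \<le> norm u * norm v" by (rule Cauchy_Schwarz_ineq2)
    moreover have "0 \<le> norm u * norm v" by simp
    ultimately show ?thesis by linarith
  qed
  then show "AE x in lebesgue_on \<Omega>. norm (f x \<bullet> h x) \<le> norm ((norm (f x))\<^sup>2 + (norm (h x))\<^sup>2)"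
    by simp
qed

lemma L2_scaleR: "f \<in> L2 \<Omega> \<Longrightarrow> (\<lambda>x. a *\<^sub>R f x) \<in> L2 \<Omega>"
  by (simp add: L2_def power_mult_distrib borel_measurable_scaleR)

lemma L2_add:
  assumes "f \<in> L2 \<Omega>" "h \<in> L2 \<Omega>"
  shows "(\<lambda>x. f x + h x) \<in> L2 \<Omega>"
proof -
  have "integrable (lebesgue_on \<Omega>) (\<lambda>x. f x \<bullet> f x + 2 * (f x \<bullet> h x) + h x \<bullet> h x)"
    using assms by (intro Bochner_Integration.integrable_add integrable_mult_right L2_integrable_inner)
  moreover have "(norm (f x + h x))\<^sup>2 = f x \<bullet> f x + 2 * (f x \<bullet> h x) + h x \<bullet> h x" for x
    by (simp add: power2_norm_eq_inner inner_add inner_commute)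
  ultimately show ?thesis using assms by (simp add: L2_def borel_measurable_add)
qed

lemma L2_zero: "(\<lambda>x. 0) \<in> L2 \<Omega>"
  by (simp add: L2_def)

lemma L2_sum:
  assumes "\<And>k. k < n \<Longrightarrow> f k \<in> L2 \<Omega>"
  shows "(\<lambda>x. \<Sum>k<(n::nat). a k *\<^sub>R f k x) \<in> L2 \<Omega>"
  using assms
proof (induction n)
  case (Suc n)
  then show ?case using L2_add[OF Suc.IH L2_scaleR[of "f n" \<Omega> "a n"]] by simp
qed (simp add: L2_zero)

lemma L2_diff:
  assumes "f \<in> L2 \<Omega>" "h \<in> L2 \<Omega>"
  shows "(\<lambda>x. f x - h x) \<in> L2 \<Omega>"
  using L2_add[OF assms(1) L2_scaleR[OF assms(2), of "-1"]] by simp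

lemma L2_component:
  fixes f :: "_ \<Rightarrow> real^'d"
  assumes "f \<in> L2 \<Omega>"
  shows "(\<lambda>x. f x $ i) \<in> L2 \<Omega>"
proof -
  have m: "(\<lambda>x. f x $ i) \<in> borel_measurable (lebesgue_on \<Omega>)"
    using measurable_compose[OF L2_measurable[OF assms], of "\<lambda>v. v $ i" borel]
    by (simp add: borel_measurable_continuous_onI continuous_on_component)
  moreover have "integrable (lebesgue_on \<Omega>) (\<lambda>x. (norm (f x $ i))\<^sup>2)"
  proof (rule Bochner_Integration.integrable_bound)
    show "integrable (lebesgue_on \<Omega>) (\<lambda>x. (norm (f x))\<^sup>2)" using assms by (simp add: L2_def)
    show "AE x in lebesgue_on \<Omega>. norm ((norm (f x $ i))\<^sup>2) \<le> norm ((norm (f x))\<^sup>2)"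
    proof (rule AE_I2)
      fix x
      have "\<bar>f x $ i\<bar>\<^sup>2 \<le> (norm (f x))\<^sup>2"
        using component_le_norm_cart[of "f x" i] by (intro power_mono) auto
      then show "norm ((norm (f x $ i))\<^sup>2) \<le> norm ((norm (f x))\<^sup>2)" by simp
    qed
  qed (use m in simp)
  ultimately show ?thesis by (simp add: L2_def)
qed

lemma L2_of_bounded:
  assumes "\<Omega> \<in> lmeasurable" "f \<in> borel_measurable (lebesgue_on \<Omega>)" "\<And>x. x \<in> \<Omega> \<Longrightarrow> norm (f x) \<le> B"
  shows "f \<in> L2 \<Omega>"
proof -
  interpret finite_measure "lebesgue_on \<Omega>" using assms(1) by (rule finite_measure_lebesgue_on)
  have "integrable (lebesgue_on \<Omega>) (\<lambda>x. (norm (f x))\<^sup>2)"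
    using assms by (intro integrable_const_bound[of _ "B\<^sup>2"]) (auto intro!: AE_I2 power_mono)
  then show ?thesis using assms by (simp add: L2_def)
qed

lemma L2_mult_bounded:
  assumes "f \<in> L2 \<Omega>" "c \<in> borel_measurable (lebesgue_on \<Omega>)" "\<And>x. x \<in> \<Omega> \<Longrightarrow> \<bar>c x\<bar> \<le> B"
  shows "(\<lambda>x. c x *\<^sub>R f x) \<in> L2 \<Omega>"
proof -
  have "integrable (lebesgue_on \<Omega>) (\<lambda>x. (norm (c x *\<^sub>R f x))\<^sup>2)"
  proof (rule Bochner_Integration.integrable_bound)
    show "integrable (lebesgue_on \<Omega>) (\<lambda>x. B\<^sup>2 * (norm (f x))\<^sup>2)" using assms by (simp add: L2_def)
    have "\<bar>c x\<bar>\<^sup>2 \<le> B\<^sup>2" if "x \<in> \<Omega>" for x using assms(3)[OF that] by (intro power_mono) auto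
    then show "AE x in lebesgue_on \<Omega>. norm ((norm (c x *\<^sub>R f x))\<^sup>2) \<le> norm (B\<^sup>2 * (norm (f x))\<^sup>2)"
      by (auto intro!: AE_I2 mult_right_mono simp: power_mult_distrib)
    note [measurable] = L2_measurable[OF assms(1)] assms(2)
    show "(\<lambda>x. (norm (c x *\<^sub>R f x))\<^sup>2) \<in> borel_measurable (lebesgue_on \<Omega>)" by measurable
  qed
  then show ?thesis using assms by (simp add: L2_def borel_measurable_scaleR)
qed

lemma L2_inner_commute: "L2_inner \<Omega> f h = L2_inner \<Omega> h f"
  by (simp add: L2_inner_def inner_commute)

lemma L2_inner_sum:
  assumes "\<And>k. k < n \<Longrightarrow> f k \<in> L2 \<Omega>" "h \<in> L2 \<Omega>"
  shows "L2_inner \<Omega> (\<lambda>x. \<Sum>k<(n::nat). a k *\<^sub>R f k x) h = (\<Sum>k<n. a k * L2_inner \<Omega> (f k) h)"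
  unfolding L2_inner_def inner_sum_left inner_scaleR_left
  by (subst Bochner_Integration.integral_sum)
     (auto intro!: integrable_mult_right L2_integrable_inner assms)

lemma L2_inner_double_sum:
  assumes "\<And>k. k < n \<Longrightarrow> f k \<in> L2 \<Omega>"
  shows "L2_inner \<Omega> (\<lambda>x. \<Sum>k<(n::nat). a k *\<^sub>R f k x) (\<lambda>x. \<Sum>k<n. b k *\<^sub>R f k x)
    = (\<Sum>k<n. \<Sum>l<n. a k * b l * L2_inner \<Omega> (f k) (f l))"
proof -
  have "L2_inner \<Omega> (f k) (\<lambda>x. \<Sum>k<n. b k *\<^sub>R f k x) = (\<Sum>l<n. b l * L2_inner \<Omega> (f k) (f l))" if "k < n" for k
    using L2_inner_sum[OF assms assms[OF that], where n = n and a = b]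
    by (simp add: L2_inner_commute[of \<Omega> "f k"])
  then show ?thesis
    by (subst L2_inner_sum[OF assms L2_sum[OF assms]]) (auto simp: sum_distrib_left mult.assoc)
qed

lemma L2_inner_diff:
  assumes "f \<in> L2 \<Omega>" "h \<in> L2 \<Omega>" "k \<in> L2 \<Omega>"
  shows "L2_inner \<Omega> f (\<lambda>x. h x - k x) = L2_inner \<Omega> f h - L2_inner \<Omega> f k"
  unfolding L2_inner_def inner_diff_right
  using assms by (intro Bochner_Integration.integral_diff L2_integrable_inner)

lemma L2_inner_cong_AE:
  assumes "AE x in lebesgue_on \<Omega>. f x = f' x" "AE x in lebesgue_on \<Omega>. h x = h' x"
    and "f \<in> borel_measurable (lebesgue_on \<Omega>)" "f' \<in> borel_measurable (lebesgue_on \<Omega>)"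
    and "h \<in> borel_measurable (lebesgue_on \<Omega>)" "h' \<in> borel_measurable (lebesgue_on \<Omega>)"
  shows "L2_inner \<Omega> f h = L2_inner \<Omega> f' h'"
  unfolding L2_inner_def by (rule integral_cong_AE) (use assms in auto)

lemma L2_inner_self_nonneg: "0 \<le> L2_inner \<Omega> f f"
  by (auto simp: L2_inner_def)

lemma L2_inner_self_eq_0:
  assumes "f \<in> L2 \<Omega>" "L2_inner \<Omega> f f = 0"
  shows "AE x in lebesgue_on \<Omega>. f x = 0"
  using integral_nonneg_eq_0_iff_AE[OF L2_integrable_inner[OF assms(1,1)]] assms(2)
  by (simp add: L2_inner_def)

lemma L2_Cauchy_Schwarz:
  assumes f: "f \<in> L2 \<Omega>" and h: "h \<in> L2 \<Omega>"
  shows "\<bar>L2_inner \<Omega> f h\<bar> \<le> L2_norm \<Omega> f * L2_norm \<Omega> h"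
proof -
  let ?A = "L2_inner \<Omega> f f" and ?B = "L2_inner \<Omega> f h" and ?C = "L2_inner \<Omega> h h"
  have "?B\<^sup>2 \<le> ?A * ?C"
  proof (cases "?C = 0")
    case True
    have "AE x in lebesgue_on \<Omega>. f x \<bullet> h x = 0"
      using L2_inner_self_eq_0[OF h True] by eventually_elim simp
    then have "?B = 0" unfolding L2_inner_def by (rule integral_eq_zero_AE)
    then show ?thesis using True by simp
  next
    case False
    then have C: "0 < ?C" using L2_inner_self_nonneg[of \<Omega> h] by simp
    \<comment> \<open>Up to a factor, the component of \<open>f\<close> orthogonal to \<open>h\<close>; its square is nonnegative.\<close>
    let ?k = "\<lambda>x. ?C *\<^sub>R f x - ?B *\<^sub>R h x"
    have "L2_inner \<Omega> ?k ?k = (\<integral>x. ?C * ?C * (f x \<bullet> f x) - 2 * ?B * ?C * (f x \<bullet> h x) + ?B * ?B * (h x \<bullet> h x) \<partial>lebesgue_on \<Omega>)"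
      unfolding L2_inner_def
      by (rule Bochner_Integration.integral_cong) (auto simp: inner_diff inner_commute algebra_simps)
    also have "\<dots> = ?C * ?C * ?A - 2 * ?B * ?C * ?B + ?B * ?B * ?C"
      using L2_integrable_inner[OF f f] L2_integrable_inner[OF f h] L2_integrable_inner[OF h h]
      by (simp add: L2_inner_def)
    also have "\<dots> = ?C * (?A * ?C - ?B\<^sup>2)" by (simp add: algebra_simps power2_eq_square)
    finally have "0 \<le> ?C * (?A * ?C - ?B\<^sup>2)" using L2_inner_self_nonneg[of \<Omega> ?k] by simp
    then show ?thesis using C by (simp add: zero_le_mult_iff)
  qed
  then show ?thesis unfolding L2_norm_def real_sqrt_mult[symmetric] by (rule real_le_rsqrt[OF order_trans[rotated]]) (simp add: )
qed

lemma continuous_in_L2: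
  assumes "open \<Omega>" "bounded \<Omega>" "continuous_on (closure \<Omega>) f"
  shows "f \<in> L2 \<Omega>"
proof -
  have "bounded (f ` closure \<Omega>)"
    using assms compact_continuous_image compact_imp_bounded compact_closure by blast
  then obtain B where "\<And>x. x \<in> closure \<Omega> \<Longrightarrow> norm (f x) \<le> B" by (auto simp: bounded_iff)
  moreover have "\<Omega> \<in> lmeasurable" using assms by (intro lmeasurable_open)
  moreover have "f \<in> borel_measurable (lebesgue_on \<Omega>)"
    using continuous_on_subset[OF assms(3) closure_subset] assms(1)
    by (intro continuous_imp_measurable_on_sets_lebesgue) auto
  ultimately show ?thesis using closure_subset by (intro L2_of_bounded) auto
qed

section \<open>Linearity of the weak gradient\<close>

lemma C_k_continuous: "C_k k f \<Longrightarrow> continuous_on UNIV f"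
  by (cases k) (simp_all add: differentiable_imp_continuous_on)

text \<open>
  The derivative vanishes on the open complement of the support, so the support does not grow. This lets
  orthogonality to test functions be applied to the components of their gradients.
\<close>

lemma test_function_partial_derivative:
  assumes "\<phi> \<in> test_functions \<Omega>"
  shows "(\<lambda>x. classical_grad \<phi> x $ i) \<in> test_functions \<Omega>"
proof -
  let ?d = "\<lambda>x. frechet_derivative \<phi> (at x) (axis i 1)"
  have smooth: "\<forall>k. C_k k \<phi>"
    and supp: "compact (closure {x. \<phi> x \<noteq> 0})" "closure {x. \<phi> x \<noteq> 0} \<subseteq> \<Omega>"
    using assms unfolding test_functions_def by blast+
  have "C_k k ?d" for k
    using smooth[rule_format, of "Suc k"] unfolding C_k.simps by blast
  moreover have sub: "closure {x. ?d x \<noteq> 0} \<subseteq> closure {x. \<phi> x \<noteq> 0}"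
  proof (rule closure_minimal[OF subsetI closed_closure])
    fix x assume "x \<in> {x. ?d x \<noteq> 0}"
    then have "?d x \<noteq> 0" by simp
    show "x \<in> closure {x. \<phi> x \<noteq> 0}"
    proof (rule ccontr)
      let ?N = "- closure {x. \<phi> x \<noteq> 0}"
      assume "x \<notin> closure {x. \<phi> x \<noteq> 0}"
      then have x: "x \<in> ?N" by simp
      have "0 = \<phi> y" if "y \<in> ?N" for y
        using that closure_subset[of "{x. \<phi> x \<noteq> 0}"] by force
      from has_derivative_transform_within_open[OF has_derivative_const _ x this]
      have "(\<phi> has_derivative (\<lambda>_. 0)) (at x)" by (simp add: open_Compl)
      then have "frechet_derivative \<phi> (at x) = (\<lambda>_. 0)" by (rule frechet_derivative_at[symmetric])
      then show False using \<open>?d x \<noteq> 0\<close> by simp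
    qed
  qed
  moreover have "compact (closure {x. ?d x \<noteq> 0})"
    using compact_Int_closed[OF supp(1) closed_closure, of "{x. ?d x \<noteq> 0}"] sub
    by (simp only: Int_absorb1)
  ultimately show ?thesis
    unfolding test_functions_def classical_grad_def vec_lambda_beta using supp(2) by blast
qed

lemma test_function_in_L2:
  assumes "open \<Omega>" "bounded \<Omega>" "\<phi> \<in> test_functions \<Omega>"
  shows "\<phi> \<in> L2 \<Omega>"
proof -
  have "C_k 0 \<phi>" using assms(3) unfolding test_functions_def by blast
  then have "continuous_on (closure \<Omega>) \<phi>"
    by (rule continuous_on_subset[OF C_k_continuous subset_UNIV])
  then show ?thesis by (rule continuous_in_L2[OF assms(1,2)])
qed

lemma classical_grad_in_L2:
  assumes "open \<Omega>" "bounded \<Omega>" "\<phi> \<in> test_functions \<Omega>"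
  shows "classical_grad \<phi> \<in> L2 \<Omega>"
proof -
  have "continuous_on UNIV (\<lambda>x. classical_grad \<phi> x $ i)" for i
  proof -
    have "C_k 0 (\<lambda>x. classical_grad \<phi> x $ i)"
      using test_function_partial_derivative[OF assms(3), of i] unfolding test_functions_def by blast
    then show ?thesis by (rule C_k_continuous)
  qed
  then have "continuous_on UNIV (\<lambda>x. \<chi> i. classical_grad \<phi> x $ i)"
    by (rule continuous_on_vec_lambda)
  then have "continuous_on (closure \<Omega>) (classical_grad \<phi>)"
    by (simp add: vec_lambda_eta continuous_on_subset[OF _ subset_UNIV])
  then show ?thesis by (rule continuous_in_L2[OF assms(1,2)])
qed

lemma wgrad_is_weak_grad: "u \<in> H1_0 \<Omega> \<Longrightarrow> is_weak_grad \<Omega> u (wgrad \<Omega> u)"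
  unfolding wgrad_def by (rule someI_ex[of "is_weak_grad \<Omega> u"]) (auto simp: H1_0_def H1_def)

lemma wgrad_in_L2: "u \<in> H1_0 \<Omega> \<Longrightarrow> wgrad \<Omega> u \<in> L2 \<Omega>"
  using wgrad_is_weak_grad by (auto simp: is_weak_grad_def)

lemma H1_0_in_L2: "u \<in> H1_0 \<Omega> \<Longrightarrow> u \<in> L2 \<Omega>"
  by (simp add: H1_0_def H1_def)

text \<open>
  Functions in \<open>L\<^sup>2\<close> are represented on the whole space, but the weak gradient sees them only inside
  \<open>\<Omega>\<close>. This transfers the initial condition, which holds in \<open>\<Omega>\<close>, to the gradients.
\<close>

lemma wgrad_cong:
  assumes "\<And>x. x \<in> \<Omega> \<Longrightarrow> u x = v x"
  shows "wgrad \<Omega> u = wgrad \<Omega> v"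
proof -
  have "(\<integral>x. u x * classical_grad \<phi> x $ i \<partial>lebesgue_on \<Omega>) = (\<integral>x. v x * classical_grad \<phi> x $ i \<partial>lebesgue_on \<Omega>)" for \<phi> i
    using assms by (intro Bochner_Integration.integral_cong) auto
  then show ?thesis by (simp add: wgrad_def is_weak_grad_def)
qed

text \<open>
  The weak gradient of a function in \<open>H1_0\<close> is an \<open>L\<^sup>2\<close> limit of gradients of test functions, whose
  components are test functions; a field orthogonal to the latter is therefore orthogonal to the limit.
\<close>

lemma orthogonal_to_wgrad:
  fixes E :: "real^'d \<Rightarrow> real^'d"
  assumes \<Omega>: "open \<Omega>" "bounded \<Omega>" and E: "E \<in> L2 \<Omega>"
    and orth: "\<And>\<phi> i. \<phi> \<in> test_functions \<Omega> \<Longrightarrow> (\<integral>x. E x $ i * \<phi> x \<partial>lebesgue_on \<Omega>) = 0"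
    and u: "u \<in> H1_0 \<Omega>"
  shows "L2_inner \<Omega> E (wgrad \<Omega> u) = 0"
proof -
  obtain \<phi> where \<phi>: "\<And>n. \<phi> n \<in> test_functions \<Omega>"
    and lim: "(\<lambda>n. L2_norm \<Omega> (\<lambda>x. classical_grad (\<phi> n) x - wgrad \<Omega> u x)) \<longlonglongrightarrow> 0"
    using u by (auto simp: H1_0_def)
  have grad: "classical_grad (\<phi> n) \<in> L2 \<Omega>" for n by (rule classical_grad_in_L2[OF \<Omega> \<phi>])
  have "L2_inner \<Omega> E (classical_grad (\<phi> n)) = 0" for n
  proof -
    have "integrable (lebesgue_on \<Omega>) (\<lambda>x. E x $ i * classical_grad (\<phi> n) x $ i)" for i
      using L2_integrable_inner[OF L2_component[OF E, of i] L2_component[OF grad, where i = i]] by simp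
    then have "L2_inner \<Omega> E (classical_grad (\<phi> n))
        = (\<Sum>i\<in>UNIV. \<integral>x. E x $ i * classical_grad (\<phi> n) x $ i \<partial>lebesgue_on \<Omega>)"
      by (simp add: L2_inner_def inner_vec_def)
    then show ?thesis using orth[OF test_function_partial_derivative[OF \<phi>]] by simp
  qed
  then have "\<bar>L2_inner \<Omega> E (wgrad \<Omega> u)\<bar>
      \<le> L2_norm \<Omega> E * L2_norm \<Omega> (\<lambda>x. classical_grad (\<phi> n) x - wgrad \<Omega> u x)" for n
    using L2_Cauchy_Schwarz[OF E L2_diff[OF grad wgrad_in_L2[OF u]], of n]
    by (simp add: L2_inner_diff[OF E grad wgrad_in_L2[OF u]])
  moreover have "(\<lambda>n. L2_norm \<Omega> E * L2_norm \<Omega> (\<lambda>x. classical_grad (\<phi> n) x - wgrad \<Omega> u x)) \<longlonglongrightarrow> 0"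
    using tendsto_mult_right_zero[OF lim] .
  ultimately have "\<bar>L2_inner \<Omega> E (wgrad \<Omega> u)\<bar> \<le> 0"
    by (intro LIMSEQ_le_const) auto
  then show ?thesis by simp
qed

text \<open>
  The defect \<open>E\<close> of linearity is orthogonal to all test functions by the definition of the weak
  gradient, hence by \<open>orthogonal_to_wgrad\<close> to every weak gradient, in particular to the summands
  that make up \<open>E\<close>. So \<open>(E, E) = 0\<close>.
\<close>

lemma wgrad_sum:
  fixes f :: "nat \<Rightarrow> real^'d \<Rightarrow> real"
  assumes \<Omega>: "open \<Omega>" "bounded \<Omega>" and f: "\<And>k. k < n \<Longrightarrow> f k \<in> H1_0 \<Omega>"
    and s: "(\<lambda>x. \<Sum>k<n. a k * f k x) \<in> H1_0 \<Omega>"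
  shows "AE x in lebesgue_on \<Omega>. wgrad \<Omega> (\<lambda>x. \<Sum>k<n. a k * f k x) x = (\<Sum>k<n. a k *\<^sub>R wgrad \<Omega> (f k) x)"
proof -
  let ?u = "\<lambda>x. \<Sum>k<n. a k * f k x" and ?D = "\<lambda>x. \<Sum>k<n. a k *\<^sub>R wgrad \<Omega> (f k) x"
  let ?E = "\<lambda>x. wgrad \<Omega> ?u x - ?D x"
  have D: "?D \<in> L2 \<Omega>" by (rule L2_sum[OF wgrad_in_L2[OF f]])
  have E: "?E \<in> L2 \<Omega>" by (rule L2_diff[OF wgrad_in_L2[OF s] D])
  have "(\<integral>x. ?E x $ i * \<phi> x \<partial>lebesgue_on \<Omega>) = 0" if \<phi>: "\<phi> \<in> test_functions \<Omega>" for \<phi> i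
  proof -
    note [simp] = test_function_in_L2[OF \<Omega> \<phi>]
    have int: "integrable (lebesgue_on \<Omega>) (\<lambda>x. w x $ i * \<phi> x)" if "w \<in> L2 \<Omega>" for w
      using L2_integrable_inner[OF L2_component[OF that, of i], of \<phi>] by simp
    have int': "integrable (lebesgue_on \<Omega>) (\<lambda>x. w x * classical_grad \<phi> x $ i)" if "w \<in> L2 \<Omega>" for w
      using L2_integrable_inner[OF that L2_component[OF classical_grad_in_L2[OF \<Omega> \<phi>], of i]] by simp
    have wg: "(\<integral>x. wgrad \<Omega> v x $ i * \<phi> x \<partial>lebesgue_on \<Omega>) = - (\<integral>x. v x * classical_grad \<phi> x $ i \<partial>lebesgue_on \<Omega>)"
      if "v \<in> H1_0 \<Omega>" for v
      using wgrad_is_weak_grad[OF that] \<phi> by (simp add: is_weak_grad_def)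
    have "(\<integral>x. ?D x $ i * \<phi> x \<partial>lebesgue_on \<Omega>)
        = (\<integral>x. (\<Sum>k<n. a k * (wgrad \<Omega> (f k) x $ i * \<phi> x)) \<partial>lebesgue_on \<Omega>)"
      by (intro Bochner_Integration.integral_cong) (auto simp: sum_distrib_right mult.assoc)
    also have "\<dots> = (\<Sum>k<n. a k * (\<integral>x. wgrad \<Omega> (f k) x $ i * \<phi> x \<partial>lebesgue_on \<Omega>))"
      by (subst Bochner_Integration.integral_sum) (auto intro!: integrable_mult_right int wgrad_in_L2 f)
    also have "\<dots> = - (\<Sum>k<n. a k * (\<integral>x. f k x * classical_grad \<phi> x $ i \<partial>lebesgue_on \<Omega>))"
      using wg[OF f] by (simp add: sum_negf)
    also have "(\<Sum>k<n. a k * (\<integral>x. f k x * classical_grad \<phi> x $ i \<partial>lebesgue_on \<Omega>))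
        = (\<integral>x. (\<Sum>k<n. a k * (f k x * classical_grad \<phi> x $ i)) \<partial>lebesgue_on \<Omega>)"
      by (subst Bochner_Integration.integral_sum) (auto intro!: integrable_mult_right int' H1_0_in_L2 f)
    also have "\<dots> = (\<integral>x. ?u x * classical_grad \<phi> x $ i \<partial>lebesgue_on \<Omega>)"
      by (intro Bochner_Integration.integral_cong) (auto simp: sum_distrib_right mult.assoc)
    also have "- \<dots> = (\<integral>x. wgrad \<Omega> ?u x $ i * \<phi> x \<partial>lebesgue_on \<Omega>)"
      using wg[OF s] by simp
    finally have eq: "(\<integral>x. ?D x $ i * \<phi> x \<partial>lebesgue_on \<Omega>) = (\<integral>x. wgrad \<Omega> ?u x $ i * \<phi> x \<partial>lebesgue_on \<Omega>)" .
    have "(\<integral>x. ?E x $ i * \<phi> x \<partial>lebesgue_on \<Omega>)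
        = (\<integral>x. wgrad \<Omega> ?u x $ i * \<phi> x - ?D x $ i * \<phi> x \<partial>lebesgue_on \<Omega>)"
      by (simp only: vector_minus_component left_diff_distrib)
    also have "\<dots> = 0"
      unfolding Bochner_Integration.integral_diff[OF int[OF wgrad_in_L2[OF s]] int[OF D]] eq by simp
    finally show ?thesis .
  qed
  then have orth: "L2_inner \<Omega> ?E (wgrad \<Omega> v) = 0" if "v \<in> H1_0 \<Omega>" for v
    using that by (intro orthogonal_to_wgrad[OF \<Omega> E]) auto
  have "L2_inner \<Omega> ?D ?E = 0"
    using L2_inner_sum[OF wgrad_in_L2[OF f] E, of n] orth[OF f] by (simp add: L2_inner_commute)
  then have "L2_inner \<Omega> ?E ?E = 0"
    using L2_inner_diff[OF E wgrad_in_L2[OF s] D] orth[OF s] by (simp add: L2_inner_commute)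
  then show ?thesis using L2_inner_self_eq_0[OF E] by simp
qed

section \<open>Locally integrable nonlinearities along polynomials\<close>

definition locally_integrable :: "(real \<Rightarrow> real) \<Rightarrow> bool" where
  "locally_integrable g \<longleftrightarrow> (\<forall>a b. set_integrable lborel {a..b} g)"

lemma locally_integrable_interval:
  assumes "locally_integrable g"
  shows "interval_lebesgue_integrable lborel (ereal a) (ereal b) g"
proof -
  have "set_integrable lborel {min a b..max a b} g"
    using assms by (simp add: locally_integrable_def)
  then have "set_integrable lborel {a<..<b} g" "set_integrable lborel {b<..<a} g"
    by (auto elim!: set_integrable_subset)
  then show ?thesis
    by (simp add: interval_lebesgue_integrable_def einterval_eq)
qed

lemma potential_diff:
  assumes "locally_integrable g"
  shows "potential g y - potential g x = (LBINT v=x..y. g v)"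
proof -
  have "(LBINT v=0..x. g v) + (LBINT v=x..y. g v) = (LBINT v=0..y. g v)"
  proof (rule interval_integral_sum)
    have "interval_lebesgue_integrable lborel (ereal (min 0 (min x y))) (ereal (max 0 (max x y))) g"
      using assms by (rule locally_integrable_interval)
    then show "interval_lebesgue_integrable lborel (min 0 (min (ereal x) (ereal y)))
        (max 0 (max (ereal x) (ereal y))) g"
      by (simp add: zero_ereal_def)
  qed
  then show ?thesis by (simp add: potential_def)
qed

lemma locally_integrable_abs:
  "locally_integrable g \<Longrightarrow> locally_integrable (\<lambda>v. \<bar>g v\<bar>)"
  by (auto simp: locally_integrable_def set_integrable_abs)

lemma locally_integrable_reflect:
  assumes "locally_integrable g"
  shows "locally_integrable (\<lambda>v. g (- v))"
  unfolding locally_integrable_def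
proof (intro allI)
  fix a b :: real
  have "set_integrable lborel {-b..-a} g"
    using assms by (simp add: locally_integrable_def)
  then have "integrable lborel (\<lambda>x. indicator {-b..-a} (0 + (-1) * x) *\<^sub>R g (0 + (-1) * x))"
    unfolding set_integrable_def by (rule lborel_integrable_real_affine) simp
  then show "set_integrable lborel {a..b} (\<lambda>v. g (- v))"
    unfolding set_integrable_def
    by (rule Bochner_Integration.integrable_cong[THEN iffD1, rotated 2])
       (auto simp: indicator_def)
qed

text \<open>
  The restrictions of \<open>g\<close> to growing intervals are measurable and converge to \<open>g\<close> pointwise.
\<close>

lemma locally_integrable_borel:
  assumes "locally_integrable g"
  shows "g \<in> borel_measurable borel"
proof (rule borel_measurable_LIMSEQ_metric)
  show "(\<lambda>x. indicator {- real n..real n} x *\<^sub>R g x) \<in> borel_measurable borel" for n :: nat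
  proof -
    have "integrable lborel (\<lambda>x. indicator {- real n..real n} x *\<^sub>R g x)"
      using assms by (simp add: locally_integrable_def set_integrable_def)
    then show ?thesis using borel_measurable_integrable by force
  qed
  show "(\<lambda>n. indicator {- real n..real n} x *\<^sub>R g x) \<longlonglongrightarrow> g x" for x :: real
  proof (rule tendsto_eventually)
    obtain m :: nat where "\<bar>x\<bar> \<le> real m" using real_arch_simple by blast
    then show "\<forall>\<^sub>F n in sequentially. indicator {- real n..real n} x *\<^sub>R g x = g x"
      unfolding eventually_sequentially by (intro exI[of _ m]) (auto simp: indicator_def)
  qed
qed

lemma interval_integral_abs_bound:
  fixes x y M :: real
  assumes g: "locally_integrable g" and "x \<in> {-M..M}" "y \<in> {-M..M}"
  shows "\<bar>LBINT v=x..y. g v\<bar> \<le> (LBINT v:{-M..M}. \<bar>g v\<bar>)"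
proof -
  have *: "\<bar>LBINT v:{x..y}. g v\<bar> \<le> (LBINT v:{-M..M}. \<bar>g v\<bar>)" if "x \<in> {-M..M}" "y \<in> {-M..M}" for x y :: real
  proof -
    have i: "set_integrable lborel {x..y} g" "set_integrable lborel {-M..M} (\<lambda>v. \<bar>g v\<bar>)"
      "set_integrable lborel {x..y} (\<lambda>v. \<bar>g v\<bar>)"
      using g locally_integrable_abs[OF g] by (auto simp: locally_integrable_def)
    have "\<bar>LBINT v:{x..y}. g v\<bar> \<le> (LBINT v:{x..y}. \<bar>g v\<bar>)"
      using set_integral_norm_bound[OF i(1)] by simp
    also have "\<dots> \<le> (LBINT v:{-M..M}. \<bar>g v\<bar>)"
      using i that unfolding set_lebesgue_integral_def set_integrable_def
      by (intro integral_mono) (auto simp: indicator_def)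
    finally show ?thesis .
  qed
  show ?thesis
  proof (cases "x \<le> y")
    case True then show ?thesis using *[OF assms(2,3)] by (simp add: interval_integral_Icc)
  next
    case False
    then show ?thesis using *[OF assms(3,2)]
      by (subst interval_integral_endpoints_reverse) (simp add: interval_integral_Icc)
  qed
qed

text \<open>
  Substitution is standard for a nonnegative derivative. The other sign follows by applying it
  to \<open>- q\<close> and the reflected integrand.
\<close>

lemma poly_substitution_monotone:
  assumes g: "locally_integrable g" and "a \<le> b"
    and sgn: "(\<forall>s\<in>{a..b}. 0 \<le> poly (pderiv q) s) \<or> (\<forall>s\<in>{a..b}. poly (pderiv q) s \<le> 0)"
  shows "set_integrable lborel {a..b} (\<lambda>s. g (poly q s) * poly (pderiv q) s)"
    and "(LBINT s:{a..b}. g (poly q s) * poly (pderiv q) s) = (LBINT v=poly q a..poly q b. g v)"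
proof -
  have *: "set_integrable lborel {a..b} (\<lambda>s. g (poly q s) * poly (pderiv q) s)
     \<and> (LBINT s=a..b. g (poly q s) * poly (pderiv q) s) = (LBINT v=poly q a..poly q b. g v)"
    if g: "locally_integrable g" and pos: "\<And>s. s \<in> {a..b} \<Longrightarrow> 0 \<le> poly (pderiv q) s" for g q
  proof -
    have "set_integrable lborel {poly q a..poly q b} g"
      using g by (simp add: locally_integrable_def)
    note s = interval_integral_substitution[OF this poly_DERIV continuous_on_poly[OF continuous_on_id] pos \<open>a \<le> b\<close>]
    show ?thesis using s by simp
  qed
  have "set_integrable lborel {a..b} (\<lambda>s. g (poly q s) * poly (pderiv q) s)
     \<and> (LBINT s=a..b. g (poly q s) * poly (pderiv q) s) = (LBINT v=poly q a..poly q b. g v)"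
    using sgn
  proof
    assume neg: "\<forall>s\<in>{a..b}. poly (pderiv q) s \<le> 0"
    have p: "0 \<le> poly (pderiv (- q)) s" if "s \<in> {a..b}" for s
      using neg that by (simp add: pderiv_minus)
    have "(LBINT s=a..b. - (g (poly q s) * poly (pderiv q) s)) = (LBINT v=-poly q a..-poly q b. g (- v))"
      using *[OF locally_integrable_reflect[OF g] p] by (simp add: pderiv_minus)
    moreover have "(LBINT v=-poly q a..-poly q b. g (- v)) = (LBINT v=poly q b..poly q a. g v)"
      by (subst (2) interval_integral_reflect) simp
    moreover have "set_integrable lborel {a..b} (\<lambda>s. g (poly q s) * poly (pderiv q) s)"
      using *[OF locally_integrable_reflect[OF g] p] by (simp add: pderiv_minus set_integrable_def)
    ultimately show ?thesis
      using interval_integral_endpoints_reverse[of "poly q a" "poly q b" g]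
      by (simp add: interval_lebesgue_integral_uminus)
  qed (use *[OF g] in auto)
  then show "set_integrable lborel {a..b} (\<lambda>s. g (poly q s) * poly (pderiv q) s)"
    and "(LBINT s:{a..b}. g (poly q s) * poly (pderiv q) s) = (LBINT v=poly q a..poly q b. g v)"
    using \<open>a \<le> b\<close> by (simp_all add: interval_integral_Icc)
qed

lemma poly_constant_sign:
  fixes p :: "real poly"
  assumes "\<And>s. a < s \<Longrightarrow> s < b \<Longrightarrow> poly p s \<noteq> 0"
  shows "(\<forall>s\<in>{a..b}. 0 \<le> poly p s) \<or> (\<forall>s\<in>{a..b}. poly p s \<le> 0)"
proof (rule ccontr)
  assume "\<not> ?thesis"
  then obtain r s where "r \<in> {a..b}" "s \<in> {a..b}" and rs: "poly p r < 0" "poly p s > 0"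
    by (auto simp: not_le)
  consider "r < s" | "s < r" using rs by (metis linorder_neqE_linordered_idom less_asym)
  then show False
  proof cases
    case 1 then show False using poly_IVT_pos[OF 1 rs] assms \<open>r \<in> {a..b}\<close> \<open>s \<in> {a..b}\<close> by force
  next
    case 2 then show False using poly_IVT_neg[OF 2 rs(2,1)] assms \<open>r \<in> {a..b}\<close> \<open>s \<in> {a..b}\<close> by force
  qed
qed

text \<open>
  Splitting at the \<open>n\<close> interior critical points of \<open>q\<close> leaves \<open>n + 1\<close> monotone pieces, on
  each of which the integral of \<open>\<bar>g(q) q'\<bar>\<close> is an integral of \<open>\<bar>g\<bar>\<close> over part of the range.
\<close>

lemma poly_chain_rule_pieces:
  assumes g: "locally_integrable g" and "a \<le> b" and q: "pderiv q \<noteq> 0"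
    and M: "\<And>s. s \<in> {a..b} \<Longrightarrow> \<bar>poly q s\<bar> \<le> M"
    and n: "card {s\<in>{a<..<b}. poly (pderiv q) s = 0} = n"
  shows "set_integrable lborel {a..b} (\<lambda>s. g (poly q s) * poly (pderiv q) s)
    \<and> (LBINT s:{a..b}. g (poly q s) * poly (pderiv q) s) = potential g (poly q b) - potential g (poly q a)
    \<and> (LBINT s:{a..b}. \<bar>g (poly q s) * poly (pderiv q) s\<bar>) \<le> (real n + 1) * (LBINT v:{-M..M}. \<bar>g v\<bar>)"
  using \<open>a \<le> b\<close> M n
proof (induction n arbitrary: a b rule: less_induct)
  case (less n)
  let ?f = "\<lambda>s. g (poly q s) * poly (pderiv q) s"
  let ?R = "\<lambda>a b. {s\<in>{a<..<b}. poly (pderiv q) s = 0}"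
  have fin: "finite (?R a b)" for a b
    by (rule finite_subset[OF _ poly_roots_finite[OF q]]) auto
  show ?case
  proof (cases "?R a b = {}")
    case True
    then have sgn: "(\<forall>s\<in>{a..b}. 0 \<le> poly (pderiv q) s) \<or> (\<forall>s\<in>{a..b}. poly (pderiv q) s \<le> 0)"
      by (intro poly_constant_sign) auto
    note s = poly_substitution_monotone[OF g \<open>a \<le> b\<close> sgn]
    note t = poly_substitution_monotone[OF locally_integrable_abs[OF g] \<open>a \<le> b\<close> sgn]
    have "(LBINT s:{a..b}. \<bar>?f s\<bar>) = \<bar>LBINT s:{a..b}. \<bar>g (poly q s)\<bar> * poly (pderiv q) s\<bar>"
      using sgn
    proof
      assume p: "\<forall>s\<in>{a..b}. 0 \<le> poly (pderiv q) s"
      have "(LBINT s:{a..b}. \<bar>?f s\<bar>) = (LBINT s:{a..b}. \<bar>g (poly q s)\<bar> * poly (pderiv q) s)"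
        using p by (intro set_lebesgue_integral_cong) (auto simp: abs_mult)
      moreover have "0 \<le> (LBINT s:{a..b}. \<bar>?f s\<bar>)"
        by (auto simp: set_lebesgue_integral_def intro!: integral_nonneg_AE)
      ultimately show ?thesis by simp
    next
      assume p: "\<forall>s\<in>{a..b}. poly (pderiv q) s \<le> 0"
      have "(LBINT s:{a..b}. \<bar>?f s\<bar>) = (LBINT s:{a..b}. - (\<bar>g (poly q s)\<bar> * poly (pderiv q) s))"
        using p by (intro set_lebesgue_integral_cong) (auto simp: abs_mult)
      also have "\<dots> = - (LBINT s:{a..b}. \<bar>g (poly q s)\<bar> * poly (pderiv q) s)"
        using t(1) by (rule set_integral_uminus)
      moreover have "0 \<le> (LBINT s:{a..b}. \<bar>?f s\<bar>)"
        by (auto simp: set_lebesgue_integral_def intro!: integral_nonneg_AE)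
      ultimately show ?thesis by simp
    qed
    also have "\<dots> = \<bar>LBINT v=poly q a..poly q b. \<bar>g v\<bar>\<bar>" using t(2) by simp
    also have "\<dots> \<le> (LBINT v:{-M..M}. \<bar>g v\<bar>)"
      using interval_integral_abs_bound[OF locally_integrable_abs[OF g], of "poly q a" M "poly q b"]
        less.prems(2)[of a] less.prems(2)[of b] \<open>a \<le> b\<close> by (simp add: abs_le_iff)
    also have "\<dots> \<le> (real n + 1) * (LBINT v:{-M..M}. \<bar>g v\<bar>)"
      by (simp add: distrib_right set_lebesgue_integral_def)
    finally show ?thesis using s by (simp add: potential_diff[OF g])
  next
    case False
    then obtain r where r: "a < r" "r < b" "poly (pderiv q) r = 0" by auto
    have R: "?R a b = insert r (?R a r \<union> ?R r b)" using r by auto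
    have cn: "n = Suc (card (?R a r) + card (?R r b))"
      unfolding less.prems(3)[symmetric] R
      by (subst card_insert_disjoint) (use fin[of a r] fin[of r b] in \<open>auto intro!: card_Un_disjoint\<close>)
    note 1 = less.IH[of "card (?R a r)" a r] and 2 = less.IH[of "card (?R r b)" r b]
    have i1: "set_integrable lborel {a..r} ?f" and i2: "set_integrable lborel {r..b} ?f"
      using 1 2 cn r less.prems by auto
    have un: "{a..b} = {a..r} \<union> {r..b}" using r by auto
    have null: "AE x in lborel. \<not> (x \<in> {a..r} \<and> x \<in> {r..b})"
      using AE_lborel_singleton[of r] by eventually_elim auto
    have "set_integrable lborel {a..b} ?f"
      unfolding un using i1 i2 by (intro set_integrable_Un) auto
    moreover have "(LBINT s:{a..b}. ?f s) = (LBINT s:{a..r}. ?f s) + (LBINT s:{r..b}. ?f s)"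
      unfolding un using i1 i2 null by (intro set_integral_Un_AE) auto
    moreover have "(LBINT s:{a..b}. \<bar>?f s\<bar>) = (LBINT s:{a..r}. \<bar>?f s\<bar>) + (LBINT s:{r..b}. \<bar>?f s\<bar>)"
      unfolding un using set_integrable_abs[OF i1] set_integrable_abs[OF i2] null 
      by (intro set_integral_Un_AE) auto
    ultimately show ?thesis using 1 2 cn r less.prems by (auto simp: algebra_simps)
  qed
qed

text \<open>
  The bound is what Fubini's theorem needs later: it depends on \<open>q\<close> only through bounds for its
  degree and its absolute value, which for the discrete solution are uniform in space.
\<close>

lemma poly_chain_rule:
  assumes g: "locally_integrable g" and ab: "a \<le> b"
    and M: "\<And>s. s \<in> {a..b} \<Longrightarrow> \<bar>poly q s\<bar> \<le> M" and d: "degree q \<le> p"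
  shows "set_integrable lborel {a..b} (\<lambda>s. g (poly q s) * poly (pderiv q) s)"
    and "(LBINT s:{a..b}. g (poly q s) * poly (pderiv q) s) = potential g (poly q b) - potential g (poly q a)"
    and "(LBINT s:{a..b}. \<bar>g (poly q s) * poly (pderiv q) s\<bar>) \<le> (real p + 1) * (LBINT v:{-M..M}. \<bar>g v\<bar>)"
proof -
  have nonneg: "0 \<le> (LBINT v:{-M..M}. \<bar>g v\<bar>)"
    by (auto simp: set_lebesgue_integral_def)
  have "set_integrable lborel {a..b} (\<lambda>s. g (poly q s) * poly (pderiv q) s)
    \<and> (LBINT s:{a..b}. g (poly q s) * poly (pderiv q) s) = potential g (poly q b) - potential g (poly q a)
    \<and> (LBINT s:{a..b}. \<bar>g (poly q s) * poly (pderiv q) s\<bar>) \<le> (real p + 1) * (LBINT v:{-M..M}. \<bar>g v\<bar>)"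
  proof (cases "pderiv q = 0")
    case True
    then obtain y where "q = [:y:]" by (auto simp: pderiv_eq_0_iff elim: degree_eq_zeroE)
    then show ?thesis using nonneg by (simp add: set_integrable_def)
  next
    case False
    let ?R = "{s\<in>{a<..<b}. poly (pderiv q) s = 0}"
    have "card ?R \<le> card {s. poly (pderiv q) s = 0}"
      by (rule card_mono[OF poly_roots_finite[OF False]]) auto
    also have "\<dots> \<le> degree (pderiv q)" by (rule card_poly_roots_bound[OF False])
    also have "\<dots> \<le> p" using d by (simp add: degree_pderiv)
    finally have "(real (card ?R) + 1) * (LBINT v:{-M..M}. \<bar>g v\<bar>) \<le> (real p + 1) * (LBINT v:{-M..M}. \<bar>g v\<bar>)"
      using nonneg by (intro mult_right_mono) auto
    then show ?thesis using poly_chain_rule_pieces[OF g ab False M refl] by auto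
  qed
  then show "set_integrable lborel {a..b} (\<lambda>s. g (poly q s) * poly (pderiv q) s)"
    and "(LBINT s:{a..b}. g (poly q s) * poly (pderiv q) s) = potential g (poly q b) - potential g (poly q a)"
    and "(LBINT s:{a..b}. \<bar>g (poly q s) * poly (pderiv q) s\<bar>) \<le> (real p + 1) * (LBINT v:{-M..M}. \<bar>g v\<bar>)"
    by auto
qed

section \<open>The energy terms on one time element\<close>

lemma pderiv_sum: "pderiv (\<Sum>k\<in>A. f k) = (\<Sum>k\<in>A. pderiv (f k))"
  by (induction A rule: infinite_finite_induct) (simp_all add: pderiv_add)

lemma lebesgue_on_integral_eq_lborel:
  fixes f :: "'a::euclidean_space \<Rightarrow> real"
  assumes "A \<in> sets borel" "(\<lambda>x. indicator A x * f x) \<in> borel_measurable borel"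
  shows "(\<integral>x. f x \<partial>lebesgue_on A) = (LBINT x. indicator A x * f x)"
  using assms by (subst integral_restrict_space) (auto intro!: integral_completion)

lemma lebesgue_on_open_interval_integral_eq:
  fixes f :: "real \<Rightarrow> real"
  assumes "(\<lambda>s. indicator {a..b} s * f s) \<in> borel_measurable borel"
  shows "(\<integral>s. f s \<partial>lebesgue_on {a<..<b}) = (LBINT s. indicator {a..b} s * f s)"
proof -
  have "(\<lambda>s. indicator {a<..<b} s * (indicator {a..b} s * f s)) \<in> borel_measurable borel"
    by (rule borel_measurable_times[OF _ assms]) simp
  also have "(\<lambda>s. indicator {a<..<b} s * (indicator {a..b} s * f s)) = (\<lambda>s. indicator {a<..<b} s * f s)"
    by (auto simp: indicator_def)
  finally have m: "(\<lambda>s. indicator {a<..<b} s * f s) \<in> borel_measurable borel" .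
  have "(\<integral>s. f s \<partial>lebesgue_on {a<..<b}) = (LBINT s. indicator {a<..<b} s * f s)"
    by (rule lebesgue_on_integral_eq_lborel) (use m in auto)
  also have "\<dots> = (LBINT s. indicator {a..b} s * f s)"
  proof (rule integral_cong_AE)
    show "AE s in lborel. indicator {a<..<b} s * f s = indicator {a..b} s * f s"
      using AE_lborel_singleton[of a] AE_lborel_singleton[of b]
      by eventually_elim (auto simp: indicator_def)
  qed (use m assms in auto)
  finally show ?thesis .
qed

lemma potential_continuous:
  assumes g: "locally_integrable g"
  shows "continuous_on {-M..M} (potential g)"
proof -
  have "g integrable_on {-M..M}"
    using g by (auto simp: locally_integrable_def intro: set_borel_integral_eq_integral(1))
  then have "continuous_on {-M..M} (\<lambda>x. potential g (-M) + integral {-M..x} g)"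
    by (intro continuous_intros indefinite_integral_continuous_1)
  moreover have "potential g (-M) + integral {-M..x} g = potential g x" if "x \<in> {-M..M}" for x
  proof -
    have "(LBINT v=-M..x. g v) = integral {-M..x} g"
      using g that by (subst interval_integral_Icc)
        (auto simp: locally_integrable_def intro: set_borel_integral_eq_integral(2))
    then show ?thesis using potential_diff[OF g, of x "-M"] by simp
  qed
  ultimately show ?thesis by (rule continuous_on_eq)
qed

text \<open>
  For fixed \<open>x\<close> the chain rule integrates \<open>g(u) u'\<close> in time. Its uniform bound makes the function
  integrable on the product of \<open>\<Omega>\<close> with the time element, although \<open>g(u(s))\<close> alone need not be
  integrable over \<open>\<Omega>\<close> for every \<open>s\<close>. Hence the order of integration may be exchanged.
\<close>

lemma potential_energy_difference:
  fixes \<Omega> :: "(real^'d) set" and \<phi> :: "nat \<Rightarrow> real^'d \<Rightarrow> real" and q :: "nat \<Rightarrow> real poly"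
  assumes \<Omega>: "open \<Omega>" "bounded \<Omega>" and \<phi>: "\<And>k. k < n \<Longrightarrow> continuous_on (closure \<Omega>) (\<phi> k)"
    and g: "locally_integrable g" and ab: "a \<le> b"
  defines "u \<equiv> \<lambda>x s. \<Sum>k<n. \<phi> k x * poly (q k) s"
    and "u' \<equiv> \<lambda>x s. \<Sum>k<n. \<phi> k x * poly (pderiv (q k)) s"
  shows "(\<integral>s. L2_inner \<Omega> (\<lambda>x. g (u x s)) (\<lambda>x. u' x s) \<partial>lebesgue_on {a<..<b})
    = potential_energy \<Omega> g (\<lambda>x. u x b) - potential_energy \<Omega> g (\<lambda>x. u x a)"
proof -
  define P where "P x = (\<Sum>k<n. smult (\<phi> k x) (q k))" for x
  define p where "p = (\<Sum>k<n. degree (q k))"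
  have P: "poly (P x) s = u x s" "poly (pderiv (P x)) s = u' x s" for x s
    by (simp_all add: P_def u_def u'_def poly_sum pderiv_sum pderiv_smult)
  have deg: "degree (P x) \<le> p" for x
    unfolding P_def
  proof (rule degree_sum_le)
    show "degree (smult (\<phi> k x) (q k)) \<le> p" if "k \<in> {..<n}" for k
      using that member_le_sum[of k "{..<n}" "\<lambda>k. degree (q k)"] degree_smult_le[of "\<phi> k x" "q k"]
      by (auto simp: p_def)
  qed simp
  have "continuous_on (closure \<Omega> \<times> {a..b}) (\<lambda>z. u (fst z) (snd z))"
    unfolding u_def
    by (intro continuous_intros continuous_on_compose2[OF \<phi>]) auto
  moreover have "compact (closure \<Omega> \<times> {a..b})"
    using \<Omega>(2) by (simp add: compact_Times compact_closure)
  ultimately have "bounded ((\<lambda>z. u (fst z) (snd z)) ` (closure \<Omega> \<times> {a..b}))"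
    by (intro compact_imp_bounded compact_continuous_image)
  then obtain M where M: "\<bar>u x s\<bar> \<le> M" if "x \<in> closure \<Omega>" "s \<in> {a..b}" for x s
    unfolding bounded_iff by fastforce
  define K where "K = (real p + 1) * (LBINT v:{-M..M}. \<bar>g v\<bar>)"
  note chain = poly_chain_rule[OF g ab _ deg, unfolded P, of _ M, folded K_def]
  have in_cl: "x \<in> closure \<Omega>" if "x \<in> \<Omega>" for x using that closure_subset by blast
  \<comment> \<open>Extended by zero, the integrand is Borel measurable in space and time jointly.\<close>
  define h where "h x s = indicator \<Omega> x * (indicator {a..b} s * (g (u x s) * u' x s))" for x s
  have "case_prod h \<in> borel_measurable (lborel \<Otimes>\<^sub>M lborel)"
  proof -
    have [measurable]: "\<Omega> \<in> sets borel" using \<Omega>(1) by simp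
    have [measurable]: "g \<in> borel_measurable borel" using g by (rule locally_integrable_borel)
    have ind: "(\<lambda>x. indicator \<Omega> x *\<^sub>R \<phi> k x) \<in> borel_measurable borel" if "k < n" for k
      using continuous_on_subset[OF \<phi>[OF that] closure_subset] \<Omega>(1)
      by (intro borel_measurable_continuous_on_indicator) auto
    have [measurable]: "(\<lambda>(x, s). \<Sum>k<n. (indicator \<Omega> x *\<^sub>R \<phi> k x) * poly (r k) s)
        \<in> borel_measurable (borel \<Otimes>\<^sub>M borel)" for r :: "nat \<Rightarrow> real poly"
    proof -
      have [measurable]: "poly (r k) \<in> borel_measurable borel" for k
        by (intro borel_measurable_continuous_onI continuous_intros)
      show ?thesis
        unfolding split_beta'
        by (intro borel_measurable_sum borel_measurable_times measurable_compose[OF measurable_fst ind]) auto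
    qed
    have "case_prod h = (\<lambda>z. indicator \<Omega> (fst z) * (indicator {a..b} (snd z) *
       (g (case z of (x, s) \<Rightarrow> \<Sum>k<n. (indicator \<Omega> x *\<^sub>R \<phi> k x) * poly (q k) s) *
        (case z of (x, s) \<Rightarrow> \<Sum>k<n. (indicator \<Omega> x *\<^sub>R \<phi> k x) * poly (pderiv (q k)) s))))"
      by (auto simp: h_def u_def u'_def fun_eq_iff indicator_def)
    also have "\<dots> \<in> borel_measurable (borel \<Otimes>\<^sub>M borel)" by measurable
    finally show ?thesis by (simp cong: measurable_cong_sets)
  qed
  note hm[measurable] = this
  have int_s: "integrable lborel (h x)" for x
  proof (cases "x \<in> \<Omega>")
    case True
    then show ?thesis using chain(1)[OF M] in_cl by (simp add: h_def[abs_def] set_integrable_def)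
  qed (simp add: h_def[abs_def])
  have eq_s: "(LBINT s. h x s) = indicator \<Omega> x * (potential g (u x b) - potential g (u x a))" for x
  proof (cases "x \<in> \<Omega>")
    case True
    then show ?thesis using chain(2)[OF M] in_cl by (simp add: h_def set_lebesgue_integral_def)
  qed (simp add: h_def)
  have abs_s: "(LBINT s. \<bar>h x s\<bar>) \<le> K * indicator \<Omega> x" for x
  proof (cases "x \<in> \<Omega>")
    case True
    then show ?thesis using chain(3)[OF M] in_cl
      by (simp add: h_def set_lebesgue_integral_def abs_mult)
  qed (simp add: h_def)
  have "integrable lborel (\<lambda>x. indicator \<Omega> x :: real)"
    using \<Omega> emeasure_bounded_finite[of \<Omega>] by (simp add: integrable_indicator_iff)
  then have K_int: "integrable lborel (\<lambda>x. K * indicator \<Omega> x)" by simp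
  have "integrable lborel (\<lambda>x. LBINT s. norm (h x s))"
  proof (rule Bochner_Integration.integrable_bound[OF K_int])
    show "(\<lambda>x. LBINT s. norm (h x s)) \<in> borel_measurable lborel" by measurable
    show "AE x in lborel. norm (LBINT s. norm (h x s)) \<le> norm (K * indicator \<Omega> x)"
    proof (rule AE_I2)
      fix x
      have "0 \<le> (LBINT s. norm (h x s))" by simp
      then show "norm (LBINT s. norm (h x s)) \<le> norm (K * indicator \<Omega> x)"
        using abs_s[of x] by simp
    qed
  qed
  then have int_h: "integrable (lborel \<Otimes>\<^sub>M lborel) (case_prod h)"
    by (intro lborel_pair.Fubini_integrable[OF hm]) (simp_all add: int_s)
  have pot_int: "integrable (lebesgue_on \<Omega>) (\<lambda>x. potential g (u x s))" if s: "s \<in> {a..b}" for s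
  proof -
    have "continuous_on (closure \<Omega>) (\<lambda>x. u x s)"
      unfolding u_def by (intro continuous_intros \<phi>) auto
    then have "continuous_on (closure \<Omega>) (\<lambda>x. potential g (u x s))"
      using M[OF _ s] by (intro continuous_on_compose2[OF potential_continuous[OF g, of M]]) fastforce+
    then have "(\<lambda>x. potential g (u x s)) \<in> L2 \<Omega>" by (rule continuous_in_L2[OF \<Omega>])
    from L2_integrable_inner[OF this continuous_in_L2[OF \<Omega> continuous_on_const[of _ "1::real"]]]
    show ?thesis by simp
  qed
  have inner_eq: "indicator {a..b} s * L2_inner \<Omega> (\<lambda>x. g (u x s)) (\<lambda>x. u' x s) = (LBINT x. h x s)" for s
  proof (cases "s \<in> {a..b}")
    case True
    have "(\<lambda>x. h x s) \<in> borel_measurable borel"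
      using measurable_Pair_compose_split[OF hm measurable_ident_sets[OF refl] measurable_const[of s]] by simp
    then show ?thesis
      using True \<Omega>(1) by (simp add: L2_inner_def h_def lebesgue_on_integral_eq_lborel)
  qed (simp add: h_def)
  have "(\<integral>s. L2_inner \<Omega> (\<lambda>x. g (u x s)) (\<lambda>x. u' x s) \<partial>lebesgue_on {a<..<b}) = (LBINT s. LBINT x. h x s)"
    unfolding inner_eq[symmetric]
  proof (rule lebesgue_on_open_interval_integral_eq)
    have "(\<lambda>s. LBINT x. h x s) \<in> borel_measurable lborel" by measurable
    then show "(\<lambda>s. indicator {a..b} s * L2_inner \<Omega> (\<lambda>x. g (u x s)) (\<lambda>x. u' x s)) \<in> borel_measurable borel"
      by (simp add: inner_eq)
  qed
  also have "\<dots> = (LBINT x. LBINT s. h x s)" by (rule lborel_pair.Fubini_integral[OF int_h])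
  also have "\<dots> = (\<integral>x. potential g (u x b) - potential g (u x a) \<partial>lebesgue_on \<Omega>)"
    unfolding eq_s
  proof (rule lebesgue_on_integral_eq_lborel[symmetric])
    have "(\<lambda>x. LBINT s. h x s) \<in> borel_measurable lborel" by measurable
    then show "(\<lambda>x. indicator \<Omega> x * (potential g (u x b) - potential g (u x a))) \<in> borel_measurable borel"
      by (simp add: eq_s)
  qed (use \<Omega> in auto)
  also have "\<dots> = potential_energy \<Omega> g (\<lambda>x. u x b) - potential_energy \<Omega> g (\<lambda>x. u x a)"
    unfolding potential_energy_def using ab by (intro Bochner_Integration.integral_diff pot_int) auto
  finally show ?thesis .
qed

text \<open>
  Expanded with the symmetric Gram matrix of the \<open>w k\<close>, the squared norm is a polynomial in time, and
  the integrand is half its derivative.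
\<close>

lemma quadratic_energy_difference:
  fixes q :: "nat \<Rightarrow> real poly"
  assumes w: "\<And>k. k < n \<Longrightarrow> w k \<in> L2 \<Omega>" and ab: "a \<le> b"
  shows "(\<integral>s. L2_inner \<Omega> (\<lambda>x. \<Sum>k<n. poly (q k) s *\<^sub>R w k x) (\<lambda>x. \<Sum>k<n. poly (pderiv (q k)) s *\<^sub>R w k x)
      \<partial>lebesgue_on {a<..<b})
    = 1 / 2 * ((L2_norm \<Omega> (\<lambda>x. \<Sum>k<n. poly (q k) b *\<^sub>R w k x))\<^sup>2
      - (L2_norm \<Omega> (\<lambda>x. \<Sum>k<n. poly (q k) a *\<^sub>R w k x))\<^sup>2)"
proof -
  define B where "B k l = L2_inner \<Omega> (w k) (w l)" for k l
  define E where "E = (\<Sum>k<n. \<Sum>l<n. smult (B k l) (q k * q l))"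
  have norm: "(L2_norm \<Omega> (\<lambda>x. \<Sum>k<n. poly (q k) s *\<^sub>R w k x))\<^sup>2 = poly E s" for s
    unfolding L2_norm_def real_sqrt_pow2[OF L2_inner_self_nonneg]
    by (simp add: L2_inner_double_sum[OF w] E_def B_def poly_sum mult_ac)
  let ?H = "\<lambda>s. \<Sum>k<n. \<Sum>l<n. poly (q k) s * poly (pderiv (q l)) s * B k l"
  have deriv: "?H s = poly (pderiv (smult (1 / 2) E)) s" for s
  proof -
    have "poly (pderiv E) s = ?H s + (\<Sum>k<n. \<Sum>l<n. poly (q l) s * poly (pderiv (q k)) s * B k l)"
      by (simp add: E_def pderiv_sum pderiv_smult pderiv_mult poly_sum sum.distrib[symmetric] algebra_simps)
    also have "(\<Sum>k<n. \<Sum>l<n. poly (q l) s * poly (pderiv (q k)) s * B k l) = ?H s"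
      by (subst sum.swap) (simp add: B_def L2_inner_commute)
    finally show ?thesis by (simp add: pderiv_smult)
  qed
  have "(\<integral>s. L2_inner \<Omega> (\<lambda>x. \<Sum>k<n. poly (q k) s *\<^sub>R w k x) (\<lambda>x. \<Sum>k<n. poly (pderiv (q k)) s *\<^sub>R w k x)
      \<partial>lebesgue_on {a<..<b}) = (\<integral>s. poly (pderiv (smult (1 / 2) E)) s \<partial>lebesgue_on {a<..<b})"
    by (simp only: L2_inner_double_sum[OF w] B_def[symmetric] deriv)
  also have "\<dots> = (LBINT s. indicator {a..b} s * poly (pderiv (smult (1 / 2) E)) s)"
  proof (rule lebesgue_on_open_interval_integral_eq)
    have [measurable]: "poly (pderiv (smult (1 / 2) E)) \<in> borel_measurable borel"
      by (intro borel_measurable_continuous_onI continuous_intros)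
    show "(\<lambda>s. indicator {a..b} s * poly (pderiv (smult (1 / 2) E)) s) \<in> borel_measurable borel"
      by measurable
  qed
  also have "\<dots> = poly (smult (1 / 2) E) b - poly (smult (1 / 2) E) a"
  proof -
    let ?Q = "smult (1 / 2) E"
    have "(poly ?Q has_vector_derivative poly (pderiv ?Q) s) (at s within {a..b})" for s
      using poly_DERIV[of ?Q s] unfolding has_real_derivative_iff_has_vector_derivative
      by (rule has_vector_derivative_at_within)
    moreover have "continuous_on {a..b} (poly (pderiv ?Q))" by (intro continuous_intros)
    ultimately show ?thesis using integral_FTC_Icc[OF ab, of "poly ?Q" "poly (pderiv ?Q)"] by simp
  qed
  finally show ?thesis by (simp add: norm algebra_simps)
qed

section \<open>The discrete spaces\<close>

lemma space_discretizationD: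
  assumes "space_discretization \<Omega> \<T> p S" and "v \<in> S"
  shows "v \<in> H1_0 \<Omega>" and "(\<lambda>x. a * v x) \<in> S" and "w \<in> S \<Longrightarrow> (\<lambda>x. v x + w x) \<in> S"
    and "K \<in> \<T> \<Longrightarrow> \<exists>f. poly_fun p f \<and> (\<forall>x\<in>K. v x = f x)"
proof -
  have "S \<subseteq> H1_0 \<Omega>" "\<forall>v\<in>S. \<forall>w\<in>S. (\<lambda>x. v x + w x) \<in> S" "\<forall>v\<in>S. \<forall>a. (\<lambda>x. a * v x) \<in> S"
    "\<forall>v\<in>S. \<forall>K\<in>\<T>. \<exists>f. poly_fun p f \<and> (\<forall>x\<in>K. v x = f x)"
    using assms(1) unfolding space_discretization_def by - (elim conjE, assumption)+
  note facts = this
  show "v \<in> H1_0 \<Omega>" using facts(1) assms(2) by (rule subsetD)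
  show "(\<lambda>x. a * v x) \<in> S" by (rule facts(3)[rule_format, OF assms(2)])
  show "(\<lambda>x. v x + w x) \<in> S" if "w \<in> S" by (rule facts(2)[rule_format, OF assms(2) that])
  show "\<exists>f. poly_fun p f \<and> (\<forall>x\<in>K. v x = f x)" if "K \<in> \<T>"
    by (rule facts(4)[rule_format, OF assms(2) that])
qed

lemma space_discretization_combination:
  assumes S: "space_discretization \<Omega> \<T> p S" and "\<And>k. k < n \<Longrightarrow> \<phi> k \<in> S"
  shows "(\<lambda>x. \<Sum>k<(n::nat). a k * \<phi> k x) \<in> S"
  using assms(2)
proof (induction n)
  case 0
  then show ?case using S by (simp add: space_discretization_def)
next
  case (Suc n)
  have "(\<lambda>x. \<Sum>k<n. a k * \<phi> k x) \<in> S" by (rule Suc.IH) (use Suc.prems in simp)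
  from space_discretizationD(3)[OF S this space_discretizationD(2)[OF S Suc.prems[of n], of "a n"]]
  show ?case by simp
qed

lemma space_discretization_continuous:
  assumes S: "space_discretization \<Omega> \<T> p S" and \<T>: "simplicial_mesh \<sigma> h \<Omega> \<T>" and v: "v \<in> S"
  shows "continuous_on (closure \<Omega>) v"
proof -
  have "finite \<T>" and un: "\<Union>\<T> = closure \<Omega>" and simplex: "\<And>K. K \<in> \<T> \<Longrightarrow> int CARD('a) simplex K"
    using \<T> by (auto simp: simplicial_mesh_def triangulation_def)
  \<comment> \<open>Polynomials on finitely many closed simplices, glued along their intersections.\<close>
  have "continuous_on (\<Union>K\<in>\<T>. K) v"
  proof (rule continuous_on_closed_Union[OF \<open>finite \<T>\<close>])
    fix K assume K: "K \<in> \<T>"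
    show "closed K" using simplex[OF K] by (rule closed_simplex)
    obtain f where f: "poly_fun p f" "\<And>x. x \<in> K \<Longrightarrow> v x = f x"
      using space_discretizationD(4)[OF S v K] by blast
    obtain a where a: "f = (\<lambda>x. \<Sum>\<alpha> | sum \<alpha> UNIV \<le> p. a \<alpha> * (\<Prod>i\<in>UNIV. x $ i ^ \<alpha> i))"
      using f(1) unfolding poly_fun_def by auto
    have "continuous_on K f"
      unfolding a
      by (intro continuous_on_sum continuous_on_mult continuous_on_const continuous_on_prod
          continuous_on_power continuous_on_component continuous_on_id)
    then show "continuous_on K v" by (rule continuous_on_eq) (simp add: f(2))
  qed
  then show ?thesis using un by simp
qed

text \<open>
  The weight \<open>c\<^sup>2\<close> is distributed over the two factors so that the gradient term becomes a Gram form
  in the fields \<open>c \<nabla>\<phi>\<^sub>k\<close>, of the same kind as the kinetic term.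
\<close>

lemma L2_inner_weighted_wgrad:
  fixes \<phi> :: "nat \<Rightarrow> real^'d \<Rightarrow> real"
  assumes S: "space_discretization \<Omega> \<T> p S" and \<Omega>: "open \<Omega>" "bounded \<Omega>"
    and c: "continuous_on (closure \<Omega>) c" and \<phi>: "\<And>k. k < n \<Longrightarrow> \<phi> k \<in> S"
  defines "w \<equiv> \<lambda>k x. c x *\<^sub>R wgrad \<Omega> (\<phi> k) x"
  shows "k < n \<Longrightarrow> w k \<in> L2 \<Omega>"
    and "L2_inner \<Omega> (\<lambda>x. (c x)\<^sup>2 *\<^sub>R wgrad \<Omega> (\<lambda>y. \<Sum>k<n. a k * \<phi> k y) x) (wgrad \<Omega> (\<lambda>y. \<Sum>k<n. b k * \<phi> k y))
      = L2_inner \<Omega> (\<lambda>x. \<Sum>k<n. a k *\<^sub>R w k x) (\<lambda>x. \<Sum>k<n. b k *\<^sub>R w k x)"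
proof -
  have H: "\<phi> k \<in> H1_0 \<Omega>" if "k < n" for k using space_discretizationD(1)[OF S \<phi>[OF that]] .
  have cm: "c \<in> borel_measurable (lebesgue_on \<Omega>)"
    using L2_measurable[OF continuous_in_L2[OF \<Omega> c]] .
  have "bounded (c ` closure \<Omega>)"
    using \<Omega>(2) c by (intro compact_imp_bounded compact_continuous_image) (auto simp: compact_closure)
  then obtain C where "\<And>x. x \<in> closure \<Omega> \<Longrightarrow> \<bar>c x\<bar> \<le> C" by (auto simp: bounded_iff)
  then have C: "\<bar>c x\<bar> \<le> C" if "x \<in> \<Omega>" for x using that closure_subset[of \<Omega>] by blast
  show w: "w k \<in> L2 \<Omega>" if "k < n" for k
    unfolding w_def by (rule L2_mult_bounded[OF wgrad_in_L2[OF H[OF that]] cm C])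
  have comb: "(\<lambda>x. c x *\<^sub>R wgrad \<Omega> (\<lambda>y. \<Sum>k<n. a k * \<phi> k y) x) \<in> L2 \<Omega>"
    "AE x in lebesgue_on \<Omega>. c x *\<^sub>R wgrad \<Omega> (\<lambda>y. \<Sum>k<n. a k * \<phi> k y) x = (\<Sum>k<n. a k *\<^sub>R w k x)" for a
  proof -
    have s: "(\<lambda>y. \<Sum>k<n. a k * \<phi> k y) \<in> H1_0 \<Omega>"
      by (rule space_discretizationD(1)[OF S space_discretization_combination[OF S \<phi>]])
    show "(\<lambda>x. c x *\<^sub>R wgrad \<Omega> (\<lambda>y. \<Sum>k<n. a k * \<phi> k y) x) \<in> L2 \<Omega>"
      by (rule L2_mult_bounded[OF wgrad_in_L2[OF s] cm C])
    show "AE x in lebesgue_on \<Omega>. c x *\<^sub>R wgrad \<Omega> (\<lambda>y. \<Sum>k<n. a k * \<phi> k y) x = (\<Sum>k<n. a k *\<^sub>R w k x)"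
    proof -
      have "AE x in lebesgue_on \<Omega>. wgrad \<Omega> (\<lambda>y. \<Sum>k<n. a k * \<phi> k y) x = (\<Sum>k<n. a k *\<^sub>R wgrad \<Omega> (\<phi> k) x)"
        by (rule wgrad_sum[OF \<Omega> H s])
      then show ?thesis by eventually_elim (simp add: w_def scaleR_sum_right mult.commute)
    qed
  qed
  have "L2_inner \<Omega> (\<lambda>x. (c x)\<^sup>2 *\<^sub>R wgrad \<Omega> (\<lambda>y. \<Sum>k<n. a k * \<phi> k y) x) (wgrad \<Omega> (\<lambda>y. \<Sum>k<n. b k * \<phi> k y))
    = L2_inner \<Omega> (\<lambda>x. c x *\<^sub>R wgrad \<Omega> (\<lambda>y. \<Sum>k<n. a k * \<phi> k y) x) (\<lambda>x. c x *\<^sub>R wgrad \<Omega> (\<lambda>y. \<Sum>k<n. b k * \<phi> k y) x)"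
    by (simp add: L2_inner_def power2_eq_square mult.assoc)
  also have "\<dots> = L2_inner \<Omega> (\<lambda>x. \<Sum>k<n. a k *\<^sub>R w k x) (\<lambda>x. \<Sum>k<n. b k *\<^sub>R w k x)"
    by (intro L2_inner_cong_AE comb(2) L2_measurable comb(1) L2_sum w)
  finally show "L2_inner \<Omega> (\<lambda>x. (c x)\<^sup>2 *\<^sub>R wgrad \<Omega> (\<lambda>y. \<Sum>k<n. a k * \<phi> k y) x) (wgrad \<Omega> (\<lambda>y. \<Sum>k<n. b k * \<phi> k y))
      = L2_inner \<Omega> (\<lambda>x. \<Sum>k<n. a k *\<^sub>R w k x) (\<lambda>x. \<Sum>k<n. b k *\<^sub>R w k x)" .
qed

lemma time_mesh_mono:
  assumes "time_mesh T N t" "i \<le> j" "j \<le> N"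
  shows "t i \<le> t j"
  using assms(2,3)
proof (induction j rule: dec_induct)
  case (step j)
  then have "t i \<le> t j" and "t j < t (Suc j)" using assms(1) by (auto simp: time_mesh_def)
  then show ?case by simp
qed simp

text \<open>
  Cutting a derivative off to one element stays in the test space: the cut-off is the derivative of
  the polynomial continued by its end values, which is continuous and constant on all other elements.
\<close>

lemma element_derivative_in_dS_time:
  assumes mesh: "time_mesh T N t" and i: "i < N" and q: "degree q \<le> p"
  shows "(\<lambda>s. if s \<in> {t i<..<t (Suc i)} then poly (pderiv q) s else 0) \<in> dS_time N t p"
proof -
  let ?a = "t i" and ?b = "t (Suc i)"
  \<comment> \<open>The polynomial on the element, continued by its end values.\<close>
  let ?\<Theta> = "\<lambda>s. poly q (max ?a (min ?b s))"
  have ab: "?a < ?b" using mesh i by (simp add: time_mesh_def)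
  have before: "?\<Theta> s = poly q ?a" if "j < i" "s \<le> t (Suc j)" for j s
  proof -
    have "s \<le> ?a" using time_mesh_mono[OF mesh, of "Suc j" i] that i by simp
    then show ?thesis using ab by simp
  qed
  have after: "?\<Theta> s = poly q ?b" if "i < j" "j < N" "t j \<le> s" for j s
  proof -
    have "?b \<le> s" using time_mesh_mono[OF mesh, of "Suc i" j] that by simp
    then show ?thesis using ab by simp
  qed
  have pieces: "\<exists>r. degree r \<le> p \<and> (\<forall>s\<in>{t j..t (Suc j)}. ?\<Theta> s = poly r s)" if "j < N" for j
  proof -
    consider "j < i" | "j = i" | "i < j" by linarith
    then show ?thesis
    proof cases
      case 1 then show ?thesis using before by (intro exI[of _ "[:poly q ?a:]"]) auto
    next
      case 2 then show ?thesis using q ab by (intro exI[of _ q]) (auto simp: max_def min_def)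
    next
      case 3 then show ?thesis using after that by (intro exI[of _ "[:poly q ?b:]"]) auto
    qed
  qed
  have "?\<Theta> \<in> S_time N t p"
    unfolding S_time_def using pieces by (auto intro!: continuous_intros)
  moreover have "(?\<Theta> has_real_derivative (if s \<in> {?a<..<?b} then poly (pderiv q) s else 0)) (at s)"
    if "j < N" and s: "s \<in> {t j<..<t (Suc j)}" for j s
  proof -
    consider "j < i" | "j = i" | "i < j" by linarith
    then show ?thesis
    proof cases
      case 1
      then have "s < ?a" using time_mesh_mono[OF mesh, of "Suc j" i] s i by auto
      have "(?\<Theta> has_real_derivative 0) (at s)"
        by (rule has_field_derivative_transform_within_open[OF DERIV_const[of "poly q ?a"], of "{..<?a}"])
           (use \<open>s < ?a\<close> ab in auto)
      then show ?thesis using \<open>s < ?a\<close> by simp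
    next
      case 2
      have "(?\<Theta> has_real_derivative poly (pderiv q) s) (at s)"
        by (rule has_field_derivative_transform_within_open[OF poly_DERIV, of "{?a<..<?b}"])
           (use s 2 in auto)
      then show ?thesis using s 2 by simp
    next
      case 3
      then have "?b < s" using time_mesh_mono[OF mesh, of "Suc i" j] s that(1) by auto
      have "(?\<Theta> has_real_derivative 0) (at s)"
        by (rule has_field_derivative_transform_within_open[OF DERIV_const[of "poly q ?b"], of "{?b<..}"])
           (use \<open>?b < s\<close> ab in auto)
      then show ?thesis using \<open>?b < s\<close> by simp
    qed
  qed
  ultimately show ?thesis
    unfolding dS_time_def by (intro CollectI bexI[of _ ?\<Theta>] allI impI ballI)
qed

lemma L2_QT_inner_localize:
  assumes sub: "{a<..<b} \<subseteq> {0<..<T}"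
    and out: "\<And>s. s \<in> {0<..<T} - {a<..<b} \<Longrightarrow> L2_inner \<Omega> (\<lambda>x. f x s) (\<lambda>x. h x s) = 0"
    and inside: "\<And>s. s \<in> {a<..<b} \<Longrightarrow> L2_inner \<Omega> (\<lambda>x. f x s) (\<lambda>x. h x s) = \<Phi> s"
  shows "L2_QT_inner \<Omega> T f h = (\<integral>s. \<Phi> s \<partial>lebesgue_on {a<..<b})"
  unfolding L2_QT_inner_def
proof (subst (1 2) integral_restrict_space)
  show "(\<integral>s. indicator {0<..<T} s *\<^sub>R L2_inner \<Omega> (\<lambda>x. f x s) (\<lambda>x. h x s) \<partial>lebesgue)
    = (\<integral>s. indicator {a<..<b} s *\<^sub>R \<Phi> s \<partial>lebesgue)"
    using sub out inside
    by (intro Bochner_Integration.integral_cong) (auto simp: indicator_def subset_iff)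
qed auto

text \<open>
  The source term vanishes almost everywhere on the cylinder, hence on almost every time slice
  almost everywhere, which is the sense in which the iterated inner product reads it.
\<close>

lemma L2_QT_inner_null:
  fixes F :: "'a::euclidean_space \<Rightarrow> real \<Rightarrow> real"
  assumes \<Omega>: "open \<Omega>" and F: "AE z in lebesgue_on (\<Omega> \<times> {0<..<T}). F (fst z) (snd z) = 0"
  shows "L2_QT_inner \<Omega> T F h = 0"
proof -
  have "open (\<Omega> \<times> {0<..<T})" using \<Omega> by (intro open_Times) auto
  then have "AE z in lborel. z \<in> \<Omega> \<times> {0<..<T} \<longrightarrow> F (fst z) (snd z) = 0"
    using F by (simp add: AE_restrict_space_iff AE_completion_iff)
  then obtain Z where Z: "Z \<in> null_sets lborel" "{z. \<not> (z \<in> \<Omega> \<times> {0<..<T} \<longrightarrow> F (fst z) (snd z) = 0)} \<subseteq> Z"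
    by (auto simp: eventually_ae_filter)
  have Z_mem: "(x, s) \<in> Z" if "x \<in> \<Omega>" "s \<in> {0<..<T}" "F x s \<noteq> 0" for x s
    by (rule subsetD[OF Z(2)]) (use that in simp)
  from Z have Zn: "Z \<in> null_sets (lborel \<Otimes>\<^sub>M lborel)" by (simp add: lborel_prod)
  then have "AE z in lborel \<Otimes>\<^sub>M lborel. z \<notin> Z" by (rule AE_not_in)
  then have "AE x in lborel. AE s in lborel. (x, s) \<notin> Z"
    by (rule lborel_pair.AE_pair)
  then have "AE s in lborel. AE x in lborel. (x, s) \<notin> Z"
  proof (subst lborel_pair.AE_commute[symmetric])
    have "{z \<in> space (lborel \<Otimes>\<^sub>M lborel). (fst z, snd z) \<notin> Z} = space (lborel \<Otimes>\<^sub>M lborel) - Z" by auto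
    also have "\<dots> \<in> sets (lborel \<Otimes>\<^sub>M lborel)" using Zn by (intro sets.Diff sets.top null_setsD2)
    finally show "{z \<in> space (lborel \<Otimes>\<^sub>M lborel). (fst z, snd z) \<notin> Z} \<in> sets (lborel \<Otimes>\<^sub>M lborel)" .
  qed
  then have "AE s in lborel. s \<in> {0<..<T} \<longrightarrow> L2_inner \<Omega> (\<lambda>x. F x s) (\<lambda>x. h x s) = 0"
  proof (elim eventually_mono, intro impI)
    fix s assume s: "AE x in lborel. (x, s) \<notin> Z" "s \<in> {0<..<T}"
    then have "AE x in lborel. x \<in> \<Omega> \<longrightarrow> F x s = 0"
      using Z_mem[OF _ s(2)] by (elim eventually_mono) blast
    then have "AE x in lebesgue_on \<Omega>. F x s = 0"
      using \<Omega> by (simp add: AE_restrict_space_iff AE_completion_iff)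
    then show "L2_inner \<Omega> (\<lambda>x. F x s) (\<lambda>x. h x s) = 0"
      unfolding L2_inner_def by (intro integral_eq_zero_AE) auto
  qed
  then have "AE s in lebesgue_on {0<..<T}. L2_inner \<Omega> (\<lambda>x. F x s) (\<lambda>x. h x s) = 0"
    by (simp add: AE_restrict_space_iff AE_completion_iff)
  then show ?thesis unfolding L2_QT_inner_def by (rule integral_eq_zero_AE)
qed

section \<open>Conservation of energy\<close>

text \<open>
  The test functions are \<open>\<partial>\<^sub>t V\<close> in the first equation and \<open>\<partial>\<^sub>t U\<close> in the second, both cut off to the
  element. The two products of \<open>\<partial>\<^sub>t U\<close> with \<open>\<partial>\<^sub>t V\<close> agree and cancel.
\<close>

lemma energy_conserved_on_element:
  fixes \<Omega> :: "(real^'d) set" and U V :: "real^'d \<Rightarrow> real \<Rightarrow> real"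
  assumes \<Omega>: "open \<Omega>" "bounded \<Omega>" and c: "continuous_on (closure \<Omega>) c"
    and g: "locally_integrable g" and \<T>: "simplicial_mesh \<sigma> h \<Omega> \<T>"
    and S: "space_discretization \<Omega> \<T> p\<^sub>x S" and mesh: "time_mesh T N t" and i: "i < N"
    and F: "AE z in lebesgue_on (\<Omega> \<times> {0<..<T}). F (fst z) (snd z) = 0"
    and sol: "scheme_solution \<Omega> T c g F S N t p U0h V0h U V"
  defines "energy \<equiv> \<lambda>s. 1 / 2 * ((L2_norm \<Omega> (\<lambda>x. V x s))\<^sup>2 + (L2_norm \<Omega> (\<lambda>x. c x *\<^sub>R grad_x \<Omega> U x s))\<^sup>2)
        + potential_energy \<Omega> g (\<lambda>x. U x s)"
  shows "energy (t (Suc i)) = energy (t i)"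
proof -
  have U_mem: "U \<in> tensor_space S (S_time N t p)" and V_mem: "V \<in> tensor_space S (S_time N t p)"
    and eq1: "\<forall>\<xi>\<in>tensor_space S (dS_time N t p). L2_QT_inner \<Omega> T (dt U) \<xi> - L2_QT_inner \<Omega> T V \<xi> = 0"
    and eq2: "\<forall>\<mu>\<in>tensor_space S (dS_time N t p). L2_QT_inner \<Omega> T (dt V) \<mu>
        + L2_QT_inner \<Omega> T (\<lambda>x s. (c x)\<^sup>2 *\<^sub>R grad_x \<Omega> U x s) (grad_x \<Omega> \<mu>)
        + L2_QT_inner \<Omega> T (\<lambda>x s. g (U x s)) \<mu> = L2_QT_inner \<Omega> T F \<mu>"
    using sol unfolding scheme_solution_def by - (elim conjE, assumption)+
  define a b where "a = t i" and "b = t (Suc i)"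
  have ab: "a < b" using mesh i by (simp add: time_mesh_def a_def b_def)
  have sub: "{a<..<b} \<subseteq> {0<..<T}"
    using time_mesh_mono[OF mesh, of 0 i] time_mesh_mono[OF mesh, of "Suc i" N] i mesh
    by (auto simp: time_mesh_def a_def b_def)
  have element: "\<exists>n \<phi> q. (\<forall>k<n. \<phi> k \<in> S \<and> degree (q k) \<le> p)
      \<and> (\<forall>x. \<forall>s\<in>{a..b}. W x s = (\<Sum>k<(n::nat). poly (q k) s * \<phi> k x))" (is "\<exists>n \<phi> q. ?P W n \<phi> q")
    if "W \<in> tensor_space S (S_time N t p)" for W
  proof -
    have "\<exists>n \<phi> \<theta>. (\<forall>k<n. \<phi> k \<in> S \<and> \<theta> k \<in> S_time N t p) \<and> W = (\<lambda>x s. \<Sum>k<(n::nat). \<phi> k x * \<theta> k s)"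
      using that by (simp only: tensor_space_def mem_Collect_eq)
    then obtain n \<phi> \<theta> where 1: "(\<forall>k<n. \<phi> k \<in> S \<and> \<theta> k \<in> S_time N t p) \<and> W = (\<lambda>x s. \<Sum>k<(n::nat). \<phi> k x * \<theta> k s)"
      by (elim exE)
    then have "\<forall>k<n. \<exists>q. degree q \<le> p \<and> (\<forall>s\<in>{a..b}. \<theta> k s = poly q s)"
      using i unfolding S_time_def a_def b_def by blast
    then obtain q where "\<forall>k<n. degree (q k) \<le> p \<and> (\<forall>s\<in>{a..b}. \<theta> k s = poly (q k) s)" by metis
    with 1 have "?P W n \<phi> q" by (auto simp: mult.commute)
    then show ?thesis by blast
  qed
  obtain n \<phi> q where \<phi>: "\<And>k. k < n \<Longrightarrow> \<phi> k \<in> S" and dq: "\<And>k. k < n \<Longrightarrow> degree (q k) \<le> p"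
    and U: "\<And>x s. s \<in> {a..b} \<Longrightarrow> U x s = (\<Sum>k<(n::nat). poly (q k) s * \<phi> k x)"
    using element[OF U_mem] by metis
  obtain m \<psi> r where \<psi>: "\<And>k. k < m \<Longrightarrow> \<psi> k \<in> S" and dr: "\<And>k. k < m \<Longrightarrow> degree (r k) \<le> p"
    and V: "\<And>x s. s \<in> {a..b} \<Longrightarrow> V x s = (\<Sum>k<(m::nat). poly (r k) s * \<psi> k x)"
    using element[OF V_mem] by metis
  define cut where "cut q s = (if s \<in> {a<..<b} then poly (pderiv q) s else 0)" for q s
  define \<mu> where "\<mu> x s = (\<Sum>k<n. cut (q k) s * \<phi> k x)" for x s
  define \<xi> where "\<xi> x s = (\<Sum>k<m. cut (r k) s * \<psi> k x)" for x s
  have test: "(\<lambda>x s. \<Sum>k<(l::nat). cut (f k) s * \<rho> k x) \<in> tensor_space S (dS_time N t p)"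
    if "\<And>k. k < l \<Longrightarrow> \<rho> k \<in> S" "\<And>k. k < l \<Longrightarrow> degree (f k) \<le> p" for l f \<rho>
  proof -
    have "cut (f k) \<in> dS_time N t p" if "k < l" for k
      using element_derivative_in_dS_time[OF mesh i, of "f k" p] \<open>k < l \<Longrightarrow> degree (f k) \<le> p\<close> that
      by (simp add: cut_def[abs_def] a_def b_def)
    with that(1) have combination: "(\<forall>k<l. \<rho> k \<in> S \<and> cut (f k) \<in> dS_time N t p)
        \<and> (\<lambda>x s. \<Sum>k<l. cut (f k) s * \<rho> k x) = (\<lambda>x s. \<Sum>k<l. \<rho> k x * cut (f k) s)"
      by (simp add: mult.commute)
    show ?thesis
      unfolding tensor_space_def mem_Collect_eq
      by (rule exI[of _ l], rule exI[of _ \<rho>], rule exI[of _ "\<lambda>k. cut (f k)"], rule combination)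
  qed
  have dt_eq: "dt W x s = (\<Sum>k<l. poly (pderiv (f k)) s * \<rho> k x)"
    if W: "\<And>x s. s \<in> {a..b} \<Longrightarrow> W x s = (\<Sum>k<(l::nat). poly (f k) s * \<rho> k x)" and s: "s \<in> {a<..<b}" for W l f \<rho> x s
  proof -
    have "((\<lambda>s. \<Sum>k<l. poly (f k) s * \<rho> k x) has_real_derivative (\<Sum>k<l. poly (pderiv (f k)) s * \<rho> k x)) (at s)"
      by (auto intro!: derivative_eq_intros poly_DERIV)
    then have "((\<lambda>s. W x s) has_real_derivative (\<Sum>k<l. poly (pderiv (f k)) s * \<rho> k x)) (at s)"
      by (rule has_field_derivative_transform_within_open[of _ _ _ "{a<..<b}"]) (use W s in auto)
    then show ?thesis unfolding dt_def by (rule DERIV_imp_deriv)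
  qed
  have dU: "dt U x s = \<mu> x s" if "s \<in> {a<..<b}" for x s
    using dt_eq[OF U that] that by (simp add: \<mu>_def cut_def)
  have dV: "dt V x s = \<xi> x s" if "s \<in> {a<..<b}" for x s
    using dt_eq[OF V that] that by (simp add: \<xi>_def cut_def)
  have \<mu>_out: "\<mu> x s = 0" and \<xi>_out: "\<xi> x s = 0" if "s \<notin> {a<..<b}" for x s
    using that by (auto simp: \<mu>_def \<xi>_def cut_def)
  have \<mu>_in: "\<mu> x s = (\<Sum>k<n. poly (pderiv (q k)) s * \<phi> k x)"
    and \<xi>_in: "\<xi> x s = (\<Sum>k<m. poly (pderiv (r k)) s * \<psi> k x)" if "s \<in> {a<..<b}" for x s
    using that by (simp_all add: \<mu>_def \<xi>_def cut_def)
  have inner_0: "L2_inner \<Omega> f (\<lambda>x. 0) = 0" "L2_inner \<Omega> (\<lambda>x. 0) f = 0" for f :: "real^'d \<Rightarrow> real" by (simp_all add: L2_inner_def)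

  have "L2_QT_inner \<Omega> T (dt U) \<xi> = (\<integral>s. L2_inner \<Omega> (\<lambda>x. \<mu> x s) (\<lambda>x. \<xi> x s) \<partial>lebesgue_on {a<..<b})"
    by (rule L2_QT_inner_localize[OF sub]) (simp_all add: dU \<xi>_out inner_0)
  moreover have "L2_QT_inner \<Omega> T (dt V) \<mu> = (\<integral>s. L2_inner \<Omega> (\<lambda>x. \<mu> x s) (\<lambda>x. \<xi> x s) \<partial>lebesgue_on {a<..<b})"
    by (rule L2_QT_inner_localize[OF sub]) (simp_all add: dV \<mu>_out inner_0 L2_inner_commute)
  ultimately have same: "L2_QT_inner \<Omega> T (dt U) \<xi> = L2_QT_inner \<Omega> T (dt V) \<mu>" by simp

  have \<psi>L2: "\<psi> k \<in> L2 \<Omega>" if "k < m" for k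
    by (rule H1_0_in_L2[OF space_discretizationD(1)[OF S \<psi>[OF that]]])
  have kin: "L2_QT_inner \<Omega> T V \<xi> = 1 / 2 * ((L2_norm \<Omega> (\<lambda>x. V x b))\<^sup>2 - (L2_norm \<Omega> (\<lambda>x. V x a))\<^sup>2)"
  proof -
    have "L2_QT_inner \<Omega> T V \<xi> = (\<integral>s. L2_inner \<Omega> (\<lambda>x. \<Sum>k<m. poly (r k) s *\<^sub>R \<psi> k x)
        (\<lambda>x. \<Sum>k<m. poly (pderiv (r k)) s *\<^sub>R \<psi> k x) \<partial>lebesgue_on {a<..<b})"
      by (rule L2_QT_inner_localize[OF sub]) (simp_all add: \<xi>_out inner_0 V \<xi>_in)
    then show ?thesis
      using quadratic_energy_difference[where q = r, OF \<psi>L2 less_imp_le[OF ab]] ab by (simp add: V)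
  qed

  define w where "w k x = c x *\<^sub>R wgrad \<Omega> (\<phi> k) x" for k x
  note wg = L2_inner_weighted_wgrad[OF S \<Omega> c \<phi>, folded w_def]
  have grad_norm: "(L2_norm \<Omega> (\<lambda>x. c x *\<^sub>R grad_x \<Omega> U x s))\<^sup>2 = (L2_norm \<Omega> (\<lambda>x. \<Sum>k<n. poly (q k) s *\<^sub>R w k x))\<^sup>2"
    if "s \<in> {a..b}" for s
  proof -
    have "(L2_norm \<Omega> (\<lambda>x. c x *\<^sub>R grad_x \<Omega> U x s))\<^sup>2
        = L2_inner \<Omega> (\<lambda>x. (c x)\<^sup>2 *\<^sub>R grad_x \<Omega> U x s) (\<lambda>x. grad_x \<Omega> U x s)"
      unfolding L2_norm_def real_sqrt_pow2[OF L2_inner_self_nonneg]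
      by (simp add: L2_inner_def power2_eq_square mult.assoc)
    also have "\<dots> = L2_inner \<Omega> (\<lambda>x. \<Sum>k<n. poly (q k) s *\<^sub>R w k x) (\<lambda>x. \<Sum>k<n. poly (q k) s *\<^sub>R w k x)"
      unfolding grad_x_def U[OF that] by (rule wg(2))
    finally show ?thesis unfolding L2_norm_def real_sqrt_pow2[OF L2_inner_self_nonneg] .
  qed
  have pot: "L2_QT_inner \<Omega> T (\<lambda>x s. (c x)\<^sup>2 *\<^sub>R grad_x \<Omega> U x s) (grad_x \<Omega> \<mu>)
      = 1 / 2 * ((L2_norm \<Omega> (\<lambda>x. c x *\<^sub>R grad_x \<Omega> U x b))\<^sup>2 - (L2_norm \<Omega> (\<lambda>x. c x *\<^sub>R grad_x \<Omega> U x a))\<^sup>2)"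
  proof -
    have "L2_QT_inner \<Omega> T (\<lambda>x s. (c x)\<^sup>2 *\<^sub>R grad_x \<Omega> U x s) (grad_x \<Omega> \<mu>)
      = (\<integral>s. L2_inner \<Omega> (\<lambda>x. \<Sum>k<n. poly (q k) s *\<^sub>R w k x)
          (\<lambda>x. \<Sum>k<n. poly (pderiv (q k)) s *\<^sub>R w k x) \<partial>lebesgue_on {a<..<b})"
    proof (rule L2_QT_inner_localize[OF sub])
      fix s assume s: "s \<in> {a<..<b}"
      then show "L2_inner \<Omega> (\<lambda>x. (c x)\<^sup>2 *\<^sub>R grad_x \<Omega> U x s) (\<lambda>x. grad_x \<Omega> \<mu> x s)
        = L2_inner \<Omega> (\<lambda>x. \<Sum>k<n. poly (q k) s *\<^sub>R w k x) (\<lambda>x. \<Sum>k<n. poly (pderiv (q k)) s *\<^sub>R w k x)"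
        using wg(2)[where a = "\<lambda>k. poly (q k) s" and b = "\<lambda>k. poly (pderiv (q k)) s"] by (simp add: grad_x_def U \<mu>_in)
    next
      fix s assume s: "s \<in> {0<..<T} - {a<..<b}"
      \<comment> \<open>The choice of weak gradient need not be the zero field for the zero function; it vanishes only almost everywhere.\<close>
      have 0: "wgrad \<Omega> (\<lambda>y. \<mu> y s) = wgrad \<Omega> (\<lambda>y. \<Sum>k<n. 0 * \<phi> k y)"
        using \<mu>_out s by simp
      have "AE x in lebesgue_on \<Omega>. wgrad \<Omega> (\<lambda>y. \<mu> y s) x = (\<Sum>k<n. 0 *\<^sub>R wgrad \<Omega> (\<phi> k) x)"
        unfolding 0
      proof (rule wgrad_sum[OF \<Omega>])
        show "\<phi> k \<in> H1_0 \<Omega>" if "k < n" for k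
          by (rule space_discretizationD(1)[OF S \<phi>[OF that]])
        show "(\<lambda>x. \<Sum>k<n. 0 * \<phi> k x) \<in> H1_0 \<Omega>"
          by (rule space_discretizationD(1)[OF S space_discretization_combination[OF S \<phi>]])
      qed
      then show "L2_inner \<Omega> (\<lambda>x. (c x)\<^sup>2 *\<^sub>R grad_x \<Omega> U x s) (\<lambda>x. grad_x \<Omega> \<mu> x s) = 0"
        unfolding L2_inner_def grad_x_def by (intro integral_eq_zero_AE) auto
    qed
    then show ?thesis
      using quadratic_energy_difference[where q = q, OF wg(1) less_imp_le[OF ab]] ab by (simp add: grad_norm)
  qed

  have nonlin: "L2_QT_inner \<Omega> T (\<lambda>x s. g (U x s)) \<mu>
      = potential_energy \<Omega> g (\<lambda>x. U x b) - potential_energy \<Omega> g (\<lambda>x. U x a)"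
  proof -
    have "L2_QT_inner \<Omega> T (\<lambda>x s. g (U x s)) \<mu>
      = (\<integral>s. L2_inner \<Omega> (\<lambda>x. g (\<Sum>k<n. \<phi> k x * poly (q k) s))
          (\<lambda>x. \<Sum>k<n. \<phi> k x * poly (pderiv (q k)) s) \<partial>lebesgue_on {a<..<b})"
      by (rule L2_QT_inner_localize[OF sub]) (simp_all add: \<mu>_out inner_0 U \<mu>_in mult.commute)
    also have "\<dots> = potential_energy \<Omega> g (\<lambda>x. U x b) - potential_energy \<Omega> g (\<lambda>x. U x a)"
      using potential_energy_difference[where q = q and \<phi> = \<phi>, OF \<Omega> space_discretization_continuous[OF S \<T> \<phi>] g less_imp_le[OF ab]] ab
      by (simp add: U mult.commute)
    finally show ?thesis .
  qed

  have "L2_QT_inner \<Omega> T (dt U) \<xi> - L2_QT_inner \<Omega> T V \<xi> = 0"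
    using eq1[rule_format, OF test[OF \<psi> dr]] by (simp add: \<xi>_def[abs_def])
  moreover have "L2_QT_inner \<Omega> T (dt V) \<mu>
        + L2_QT_inner \<Omega> T (\<lambda>x s. (c x)\<^sup>2 *\<^sub>R grad_x \<Omega> U x s) (grad_x \<Omega> \<mu>)
        + L2_QT_inner \<Omega> T (\<lambda>x s. g (U x s)) \<mu> = L2_QT_inner \<Omega> T F \<mu>"
    using eq2[rule_format, OF test[OF \<phi> dq]] by (simp add: \<mu>_def[abs_def])
  ultimately show ?thesis
    unfolding energy_def a_def[symmetric] b_def[symmetric]
    using same kin pot nonlin L2_QT_inner_null[OF \<Omega>(1) F, of \<mu>] by (simp add: algebra_simps)
qed

theorem lemma3p5:
  fixes \<Omega> :: "(real^'d) set" and T \<sigma> h\<^sub>x c0 :: real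
    and c U0 V0 U0h V0h :: "real^'d \<Rightarrow> real"
    and g :: "real \<Rightarrow> real" and F U V :: "real^'d \<Rightarrow> real \<Rightarrow> real"
    and \<T> :: "(real^'d) set set" and S :: "(real^'d \<Rightarrow> real) set"
    and t :: "nat \<Rightarrow> real" and p\<^sub>x p\<^sub>t N\<^sub>t :: nat
  assumes "CARD('d) \<in> {1, 2, 3}"
    and "lipschitz_domain \<Omega>" and "polytopal \<Omega>" and "0 < T"
    and "continuous_on (closure \<Omega>) c" and "0 < c0" and "\<And>x. x \<in> \<Omega> \<Longrightarrow> c0 \<le> c x"
    and "U0 \<in> H1_0 \<Omega>" and "V0 \<in> L2 \<Omega>"
    and "g 0 = 0" and "\<And>a b. set_integrable lborel {a..b} g"
    and "1 \<le> p\<^sub>x" and "0 < \<sigma>" and "simplicial_mesh \<sigma> h\<^sub>x \<Omega> \<T>" and "space_discretization \<Omega> \<T> p\<^sub>x S"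
    and "1 \<le> p\<^sub>t" and "time_mesh T N\<^sub>t t"
    and "U0h \<in> S" and "V0h \<in> S"
    and "\<And>W. W \<in> S \<Longrightarrow>
           L2_inner \<Omega> (\<lambda>x. (c x)\<^sup>2 *\<^sub>R wgrad \<Omega> U0h x) (wgrad \<Omega> W) =
           L2_inner \<Omega> (\<lambda>x. (c x)\<^sup>2 *\<^sub>R wgrad \<Omega> U0 x) (wgrad \<Omega> W)"
    and "\<And>W. W \<in> S \<Longrightarrow> L2_inner \<Omega> V0h W = L2_inner \<Omega> V0 W"
    and "AE z in lebesgue_on (\<Omega> \<times> {0<..<T}). F (fst z) (snd z) = 0"
    and "scheme_solution \<Omega> T c g F S N\<^sub>t t p\<^sub>t U0h V0h U V"
  shows "\<forall>j\<le>N\<^sub>t.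
      1 / 2 * ((L2_norm \<Omega> (\<lambda>x. V x (t j)))\<^sup>2
        + (L2_norm \<Omega> (\<lambda>x. c x *\<^sub>R grad_x \<Omega> U x (t j)))\<^sup>2)
        + potential_energy \<Omega> g (\<lambda>x. U x (t j))
    = 1 / 2 * ((L2_norm \<Omega> V0h)\<^sup>2 + (L2_norm \<Omega> (\<lambda>x. c x *\<^sub>R wgrad \<Omega> U0h x))\<^sup>2)
        + potential_energy \<Omega> g U0h"
proof -
  have \<Omega>: "open \<Omega>" "bounded \<Omega>" using \<open>lipschitz_domain \<Omega>\<close> by (auto simp: lipschitz_domain_def)
  have g: "locally_integrable g"
    using \<open>\<And>a b. set_integrable lborel {a..b} g\<close> by (simp add: locally_integrable_def)
  let ?energy = "\<lambda>s. 1 / 2 * ((L2_norm \<Omega> (\<lambda>x. V x s))\<^sup>2 + (L2_norm \<Omega> (\<lambda>x. c x *\<^sub>R grad_x \<Omega> U x s))\<^sup>2)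
        + potential_energy \<Omega> g (\<lambda>x. U x s)"
  let ?E0 = "1 / 2 * ((L2_norm \<Omega> V0h)\<^sup>2 + (L2_norm \<Omega> (\<lambda>x. c x *\<^sub>R wgrad \<Omega> U0h x))\<^sup>2)
        + potential_energy \<Omega> g U0h"
  have "t 0 = 0" using \<open>time_mesh T N\<^sub>t t\<close> by (simp add: time_mesh_def)
  have U0: "U x 0 = U0h x" and V0: "V x 0 = V0h x" if "x \<in> \<Omega>" for x
    using \<open>scheme_solution \<Omega> T c g F S N\<^sub>t t p\<^sub>t U0h V0h U V\<close> that by (auto simp: scheme_solution_def)
  have "L2_norm \<Omega> (\<lambda>x. V x 0) = L2_norm \<Omega> V0h"
    unfolding L2_norm_def L2_inner_def using V0
    by (intro arg_cong[where f = sqrt] Bochner_Integration.integral_cong) auto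
  moreover have "(\<lambda>x. grad_x \<Omega> U x 0) = wgrad \<Omega> U0h"
    unfolding grad_x_def using U0 by (intro wgrad_cong)
  then have "(\<lambda>x. c x *\<^sub>R grad_x \<Omega> U x 0) = (\<lambda>x. c x *\<^sub>R wgrad \<Omega> U0h x)"
    by (simp add: fun_eq_iff)
  moreover have "potential_energy \<Omega> g (\<lambda>x. U x 0) = potential_energy \<Omega> g U0h"
    unfolding potential_energy_def using U0 by (intro Bochner_Integration.integral_cong) auto
  ultimately have init: "?energy (t 0) = ?E0" by (simp only: \<open>t 0 = 0\<close>)
  have "?energy (t j) = ?E0" if "j \<le> N\<^sub>t" for j
    using that
  proof (induction j)
    case 0
    show ?case by (rule init)
  next
    case (Suc j)
    have "?energy (t (Suc j)) = ?energy (t j)"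
      by (rule energy_conserved_on_element[OF \<Omega> assms(5) g assms(14,15,17) _ assms(22,23)]) (use Suc.prems in simp)
    then show ?case using Suc.IH Suc.prems by simp
  qed
  then show ?thesis by blast
qed

end
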